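(* Let $\Omega$ be a domain in $\mathbb{R}^{m+n}$, $m,n\geq 2$. Let $u:\Omega\to[-\infty,+\infty)$ be such that (a) for each $y\in\mathbb{R}^n$ the function $\Omega(y)\ni x\mapsto u(x,y)\in[-\infty,+\infty)$ is nearly subharmonic, and, for almost every $y\in\mathbb{R}^n$, subharmonic, (b) for each $x\in\mathbb{R}^m$ the function $\Omega(x)\ni y\mapsto u(x,y)\in[-\infty,+\infty)$ is upper semicontinuous, and, for almost every $x\in\mathbb{R}^m$, subharmonic, (c) there exists a non-constant permissible function $\psi:[0,+\infty)\to[0,+\infty)$ such that $\psi\circ u^+\in\mathcal{L}^1_{\mathrm{loc}}(\Omega)$. Then $u$ is subharmonic in $\Omega$.
   Context: Points of $\mathbb{R}^{m+n}$ are written $(x,y)$ with $x\in\mathbb{R}^m$, $y\in\mathbb{R}^n$. For $\Omega\subset\mathbb{R}^{m+n}$ put $\Omega(y)=\{x\in\mathbb{R}^m:(x,y)\in\Omega\}$ and $\Omega(x)=\{y\in\mathbb{R}^n:(x,y)\in\Omega\}$ (open, possibly empty or disconnected; definitions below are applied verbatim on them). $m_N$ is Lebesgue measure on $\mathbb{R}^N$, $B^N(x,r)$ the open ball, $\nu_N=m_N(B^N(0,1))$, and $u^+=\max\{u,0\}$. Let $D\subset\mathbb{R}^N$ be open, $N\ge2$. An upper semicontinuous $u:D\to[-\infty,+\infty)$ is subharmonic if $u(x)\leq\frac{1}{\nu_N r^N}\int_{B^N(x,r)}u\,dm_N$ for all closed balls $\overline{B^N(x,r)}\subset D$; the function $u\equiv-\infty$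 is considered subharmonic. A function $u:D\to[-\infty,+\infty)$ is nearly subharmonic if it is Lebesgue measurable, $u^+\in\mathcal{L}^1_{\mathrm{loc}}(D)$, and the same mean value inequality holds for all $\overline{B^N(x,r)}\subset D$. A function $\varphi:[0,+\infty)\to[0,+\infty)$ satisfies the $\Delta_2$-condition if there is a constant $C\geq1$ with $\varphi(2t)\leq C\varphi(t)$ for all $t\geq0$. A function $\psi:[0,+\infty)\to[0,+\infty)$ is permissible if there exist an increasing (strictly or not), convex function $\psi_1:[0,+\infty)\to[0,+\infty)$ and a strictly increasing surjection $\psi_2:[0,+\infty)\to[0,+\infty)$ such that $\psi=\psi_2\circ\psi_1$, $\psi_1$ satisfies the $\Delta_2$-condition, $\psi_2^{-1}$ satisfies the $\Delta_2$-condition, and $t\mapsto\psi_2(t)/t$ is quasi-decreasing, i.e. there is $C>0$ with $\psi_2(s)/s\geq C\,\psi_2(t)/t$ for all $0<s\leq t$. *)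

theory Defs
  imports "HOL-Analysis.Analysis"
begin

definition usc_on :: "'a::topological_space set \<Rightarrow> ('a \<Rightarrow> ereal) \<Rightarrow> bool" where
  "usc_on D u \<longleftrightarrow> (\<forall>x\<in>D. \<forall>a. u x < a \<longrightarrow> (\<forall>\<^sub>F y in at x within D. u y < a))"

text \<open>
  The integral of the positive part minus the integral of the negative part
  (\<^const>\<open>e2ennreal\<close> truncates negative values to 0). In \<^typ>\<open>ereal\<close> the difference of two
  infinities is \<open>\<infinity>\<close>, but this case never arises below: the integral of the positive part is finite
  over every compact subset of \<open>D\<close>, both for upper semicontinuous functions \<open>D \<rightarrow> [-\<infinity>, \<infinity>)\<close>
  and for functions with locally integrable positive part.
\<close>

definition ereal_integral :: "'a measure \<Rightarrow> ('a \<Rightarrow> ereal) \<Rightarrow> ereal" where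
  "ereal_integral M f =
     enn2ereal (\<integral>\<^sup>+x. e2ennreal (f x) \<partial>M) - enn2ereal (\<integral>\<^sup>+x. e2ennreal (- f x) \<partial>M)"

definition ball_mean :: "('a::euclidean_space \<Rightarrow> ereal) \<Rightarrow> 'a \<Rightarrow> real \<Rightarrow> ereal" where
  "ball_mean u x r =
     ereal (1 / (measure lebesgue (ball (0::'a) 1) * r ^ DIM('a))) *
     ereal_integral (lebesgue_on (ball x r)) u"

definition sub_mean_value_on :: "'a::euclidean_space set \<Rightarrow> ('a \<Rightarrow> ereal) \<Rightarrow> bool" where
  "sub_mean_value_on D u \<longleftrightarrow> (\<forall>x r. 0 < r \<and> cball x r \<subseteq> D \<longrightarrow> u x \<le> ball_mean u x r)"

definition subharmonic_on :: "'a::euclidean_space set \<Rightarrow> ('a \<Rightarrow> ereal) \<Rightarrow> bool" where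
  "subharmonic_on D u \<longleftrightarrow>
     (\<forall>x\<in>D. u x < \<infinity>) \<and> usc_on D u \<and> sub_mean_value_on D u"

lemma subharmonic_on_minus_infinity: "subharmonic_on D (\<lambda>_. -\<infinity>)"
  by (simp add: subharmonic_on_def usc_on_def sub_mean_value_on_def)

text \<open>Real-valued, so \<open>pos_part u x\<close> is \<open>u\<^sup>+ x\<close> only where \<open>u x < \<infinity>\<close>.\<close>

definition pos_part :: "('a \<Rightarrow> ereal) \<Rightarrow> 'a \<Rightarrow> real" where
  "pos_part u x = real_of_ereal (max (u x) 0)"

definition locally_integrable_on :: "'a::euclidean_space set \<Rightarrow> ('a \<Rightarrow> real) \<Rightarrow> bool" where
  "locally_integrable_on D f \<longleftrightarrow> (\<forall>K. compact K \<and> K \<subseteq> D \<longrightarrow> set_integrable lebesgue K f)"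

definition nearly_subharmonic_on :: "'a::euclidean_space set \<Rightarrow> ('a \<Rightarrow> ereal) \<Rightarrow> bool" where
  "nearly_subharmonic_on D u \<longleftrightarrow>
     (\<forall>x\<in>D. u x < \<infinity>) \<and> u \<in> borel_measurable (lebesgue_on D) \<and>
     locally_integrable_on D (pos_part u) \<and> sub_mean_value_on D u"

text \<open>Functions \<open>[0, \<infinity>) \<rightarrow> [0, \<infinity>)\<close> are represented by the restrictions of
  functions \<^typ>\<open>real \<Rightarrow> real\<close> to \<open>{0..}\<close>; their values at negative arguments play no role.\<close>

definition Delta2 :: "(real \<Rightarrow> real) \<Rightarrow> bool" where
  "Delta2 \<phi> \<longleftrightarrow> (\<exists>C\<ge>1. \<forall>t\<ge>0. \<phi> (2 * t) \<le> C * \<phi> t)"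

definition permissible :: "(real \<Rightarrow> real) \<Rightarrow> bool" where
  "permissible \<psi> \<longleftrightarrow> (\<exists>\<psi>1 \<psi>2.
     \<psi>1 \<in> {0..} \<rightarrow> {0..} \<and> mono_on {0..} \<psi>1 \<and> convex_on {0..} \<psi>1 \<and>
     strict_mono_on {0..} \<psi>2 \<and> \<psi>2 ` {0..} = {0..} \<and>
     (\<forall>t\<ge>0. \<psi> t = \<psi>2 (\<psi>1 t)) \<and>
     Delta2 \<psi>1 \<and> Delta2 (inv_into {0..} \<psi>2) \<and>
     (\<exists>C>0. \<forall>s t. 0 < s \<and> s \<le> t \<longrightarrow> \<psi>2 s / s \<ge> C * (\<psi>2 t / t)))"

end

theory Submission
  imports Defs
begin

text \<open>
  The argument works with the functions \<open>f = (u + M)\<^sup>+\<close> for real \<open>M\<close>, which are nonnegative and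
  inherit the hypotheses on slices.

  First, \<open>u\<close> is bounded above on compact sets. Write \<open>\<psi> = \<phi> \<circ> \<psi>1\<close> with \<open>\<psi>1\<close> convex, increasing and not
  constant, so that \<open>\<psi>1 t \<ge> a * (t - s)\<^sup>+\<close> for some \<open>a > 0\<close>. Hence \<open>v = a * (u - s)\<^sup>+\<close> has the
  sub-mean value property on slices and \<open>\<phi> \<circ> v\<close> is locally dominated by the locally integrable function
  \<open>\<psi> \<circ> u\<^sup>+\<close>. The conditions on \<open>\<phi>\<close> yield a mean value inequality with a constant for \<open>\<phi> \<circ> v\<close>
  (\<open>quasi_mean_value\<close>); used in \<open>y\<close> and then in \<open>x\<close>, it bounds \<open>\<phi> \<circ> v\<close>, hence \<open>u\<close> from above,
  uniformly on compact sets (\<open>locally_bounded_above\<close>).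

  Second, \<open>u\<close> is jointly upper semicontinuous. The mean of \<open>f\<close> in \<open>x\<close> over balls of radius \<open>r\<close> is jointly
  upper semicontinuous because \<open>f\<close> is so in \<open>y\<close>, and it dominates \<open>f\<close>. As \<open>r \<rightarrow> 0\<close>, these
  means at \<open>(x0, y0)\<close> are asymptotically at most the mean of \<open>f (x0, \<cdot>)\<close> over any small ball around
  \<open>y0\<close> (\<open>ball_int_less_slice_mean\<close>), which for small balls exceeds \<open>f (x0, y0)\<close> by at most
  an arbitrarily small amount, by upper semicontinuity in \<open>y\<close>. The same estimate shows that \<open>f (x0, \<cdot>)\<close> has the sub-mean value property for every
  \<open>x0\<close> and not only for almost every one (\<open>submean_y_all\<close>, \<open>joint_usc\<close>).

  Third, slicing a Euclidean ball in the product space by Tonelli's theorem, once in each variable, gives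
  the sub-mean value property of \<open>f\<close> there (\<open>submean_on_prod\<close>). Letting \<open>M \<rightarrow> \<infinity>\<close> gives that of
  \<open>u\<close>.
\<close>

section \<open>The sub-mean value property and truncation from below\<close>

text \<open>
  The sub-mean value property over balls for functions with values in \<open>[0, \<infinity>]\<close>, without
  division. For such functions the integral always makes sense (as a supremum over measurable simple
  minorants), so measurability of \<open>f\<close> is not built in.
\<close>

definition submean_on :: "'a::euclidean_space set \<Rightarrow> ('a \<Rightarrow> ennreal) \<Rightarrow> bool" where
  "submean_on D f \<longleftrightarrow> (\<forall>x r. 0 < r \<and> cball x r \<subseteq> D \<longrightarrow>
     f x * emeasure lborel (ball x r) \<le> (\<integral>\<^sup>+z\<in>ball x r. f z \<partial>lebesgue))"

text \<open>
  The function \<open>(u + M)\<^sup>+\<close>. For \<open>M < 0\<close> it vanishes where \<open>u\<close> is below \<open>-M\<close>; for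
  \<open>M \<rightarrow> \<infinity>\<close> it recovers \<open>u\<close> as \<open>shift_pos M u - M\<close> in the limit. It is finite wherever
  \<open>u < \<infinity>\<close>.
\<close>

definition shift_pos :: "real \<Rightarrow> ('a \<Rightarrow> ereal) \<Rightarrow> 'a \<Rightarrow> ennreal" where
  "shift_pos M u z = e2ennreal (u z + ereal M)"

lemma e2ennreal_less_iff: "e2ennreal e < a \<longleftrightarrow> 0 < a \<and> e < enn2ereal a"
proof (cases "0 \<le> e")
  case True
  then show ?thesis
    by (metis enn2ereal_e2ennreal less_ennreal.rep_eq not_gr_zero zero_ennreal.rep_eq leD)
next
  case False
  then have "e2ennreal e = 0" "e < 0" by (auto simp: e2ennreal_neg)
  then show ?thesis
    using enn2ereal_nonneg[of a] by (auto intro: less_le_trans)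
qed

lemma shift_pos_less_iff:
  "shift_pos M u z < a \<longleftrightarrow> 0 < a \<and> u z < enn2ereal a - ereal M"
  unfolding shift_pos_def e2ennreal_less_iff
  by (cases "u z"; cases "enn2ereal a") auto

lemma shift_pos_less_top: "u z < \<infinity> \<Longrightarrow> shift_pos M u z < top"
  unfolding shift_pos_less_iff by (cases "u z") (auto simp: top_ennreal.rep_eq top_ereal_def)

lemma shift_pos_le_iff:
  assumes "0 \<le> L" shows "shift_pos M u z \<le> ennreal L \<longleftrightarrow> u z \<le> ereal (L - M)"
  using assms unfolding shift_pos_def
  by (cases "u z") (auto simp: e2ennreal_neg ennreal_le_iff top_unique)

lemma emeasure_ball_unit:
  fixes x :: "'a::euclidean_space"
  assumes "0 < r"
  shows "emeasure lborel (ball x r) = ennreal (measure lebesgue (ball (0::'a) 1) * r ^ DIM('a))"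
    and "0 < measure lebesgue (ball (0::'a) 1) * r ^ DIM('a)"
proof -
  have "measure lebesgue (ball (0::'a) 1) = unit_ball_vol (DIM('a))"
    using content_ball[of 1 "0::'a"] by (simp add: measure_completion)
  then show "emeasure lborel (ball x r) = ennreal (measure lebesgue (ball (0::'a) 1) * r ^ DIM('a))"
    "0 < measure lebesgue (ball (0::'a) 1) * r ^ DIM('a)"
    using emeasure_ball[of r x] assms by (auto intro!: mult_pos_pos unit_ball_vol_pos)
qed

lemma nn_integral_lebesgue_on_ball:
  "nn_integral (lebesgue_on (ball x r)) f = (\<integral>\<^sup>+z\<in>ball x r. f z \<partial>lebesgue)"
  by (rule nn_integral_restrict_space) auto

lemma ball_mean_eq:
  fixes x :: "'a::euclidean_space"
  shows "ball_mean u x r = ereal (1 / (measure lebesgue (ball (0::'a) 1) * r ^ DIM('a))) *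
     (enn2ereal (\<integral>\<^sup>+z\<in>ball x r. e2ennreal (u z) \<partial>lebesgue) -
      enn2ereal (\<integral>\<^sup>+z\<in>ball x r. e2ennreal (- u z) \<partial>lebesgue))"
  unfolding ball_mean_def ereal_integral_def nn_integral_lebesgue_on_ball ..

lemma borel_measurable_e2ennreal[measurable]: "e2ennreal \<in> borel_measurable borel"
  by (intro borel_measurable_continuous_onI continuous_on_e2ennreal)

lemma nn_set_integral_eq_lebesgue_on:
  assumes "B \<in> sets lebesgue"
  shows "(\<integral>\<^sup>+z\<in>B. f z \<partial>lebesgue) = nn_integral (lebesgue_on B) f"
  using assms by (subst nn_integral_restrict_space) auto

lemma borel_measurable_shift_pos[measurable]:
  "u \<in> borel_measurable M \<Longrightarrow> shift_pos c u \<in> borel_measurable M"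
  unfolding shift_pos_def[abs_def]
  by (intro measurable_compose[OF _ borel_measurable_e2ennreal] borel_measurable_ereal_add) auto

text \<open>
  Truncation from below preserves the sub-mean value property. Integrals of positive and negative
  parts may be infinite a priori, so the proof compares \<open>u\<^sup>+ + M\<close> with \<open>u\<^sup>- + (u + M)\<^sup>+\<close>,
  moving all negative terms to the other side.
\<close>
lemma submean_on_shift_pos:
  fixes D :: "'a::euclidean_space set"
  assumes sm: "sub_mean_value_on D u" and meas: "u \<in> borel_measurable (lebesgue_on D)"
  shows "submean_on D (shift_pos M u)"
  unfolding submean_on_def
proof (intro allI impI, elim conjE)
  fix x :: 'a and r :: real assume r: "0 < r" and sub: "cball x r \<subseteq> D"
  let ?B = "ball x r" and ?L = "lebesgue_on (ball x r)"
  define v where "v = measure lebesgue (ball (0::'a) 1) * r ^ DIM('a)"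
  have v: "0 < v" "emeasure lborel ?B = ennreal v"
    using emeasure_ball_unit[OF r] by (auto simp: v_def)
  have [measurable]: "u \<in> borel_measurable ?L"
    using sub by (intro measurable_restrict_mono[OF meas]) auto
  define P where "P = (\<integral>\<^sup>+z. e2ennreal (u z) \<partial>?L)"
  define N where "N = (\<integral>\<^sup>+z. e2ennreal (- u z) \<partial>?L)"
  define T where "T = (\<integral>\<^sup>+z. shift_pos M u z \<partial>?L)"
  have const: "(\<integral>\<^sup>+z. ennreal c \<partial>?L) = ennreal c * ennreal v"
    "emeasure ?L ?B = ennreal v" for c
    using v(2) by (simp_all add: emeasure_restrict_space)
  have le1: "P \<le> T + ennreal (-M) * ennreal v"
  proof -
    have "P \<le> (\<integral>\<^sup>+z. shift_pos M u z + ennreal (-M) \<partial>?L)"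
      unfolding P_def
    proof (rule nn_integral_mono)
      fix z show "e2ennreal (u z) \<le> shift_pos M u z + ennreal (-M)"
        unfolding shift_pos_def
        by (cases "u z") (auto simp: ennreal_plus_if ennreal_neg e2ennreal_neg intro!: ennreal_leI)
    qed
    also have "\<dots> = T + ennreal (-M) * ennreal v"
      unfolding T_def by (subst nn_integral_add) (auto simp: const)
    finally show ?thesis .
  qed
  have le2: "P + ennreal M * ennreal v \<le> N + T + ennreal (-M) * ennreal v"
  proof -
    have "(\<integral>\<^sup>+z. e2ennreal (u z) + ennreal M \<partial>?L) \<le>
      (\<integral>\<^sup>+z. (e2ennreal (- u z) + shift_pos M u z) + ennreal (-M) \<partial>?L)"
    proof (rule nn_integral_mono)
      fix z show "e2ennreal (u z) + ennreal M \<le> (e2ennreal (- u z) + shift_pos M u z) + ennreal (-M)"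
        unfolding shift_pos_def
        by (cases "u z") (auto simp: ennreal_plus_if ennreal_neg e2ennreal_neg intro!: ennreal_leI)
    qed
    also have "(\<integral>\<^sup>+z. e2ennreal (u z) + ennreal M \<partial>?L) = P + ennreal M * ennreal v"
      unfolding P_def by (subst nn_integral_add) (auto simp: const)
    also have "(\<integral>\<^sup>+z. (e2ennreal (- u z) + shift_pos M u z) + ennreal (-M) \<partial>?L)
       = N + T + ennreal (-M) * ennreal v"
      unfolding N_def T_def
      by (subst nn_integral_add, measurable, subst nn_integral_add) (auto simp: const)
    finally show ?thesis .
  qed
  have "u x \<le> ball_mean u x r"
    using sm r sub unfolding sub_mean_value_on_def by blast
  then have mv: "u x \<le> ereal (1 / v) * (enn2ereal P - enn2ereal N)"
    by (simp add: ball_mean_eq nn_set_integral_eq_lebesgue_on P_def N_def v_def)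
  have "shift_pos M u x * ennreal v \<le> T"
  proof (cases T)
    case top then show ?thesis by simp
  next
    case (real t)
    then have "P < top" using le1 by (auto simp: ennreal_mult_less_top intro: le_less_trans)
    then obtain p where p: "P = ennreal p" "0 \<le> p" by (cases P) auto
    show ?thesis
    proof (cases "N = top \<or> u x = -\<infinity>")
      case True
      then have "u x = -\<infinity>"
        using mv p v(1) by (auto simp: top_ennreal.rep_eq top_ereal_def)
      then show ?thesis by (simp add: shift_pos_def e2ennreal_neg)
    next
      case False
      then obtain n where n: "N = ennreal n" "0 \<le> n" by (cases N) auto
      from mv p n have "u x \<le> ereal ((p - n) / v)" by simp
      then obtain a where a: "u x = ereal a" "a \<le> (p - n) / v" using False by (cases "u x") auto
      have e: "ennreal c * ennreal v = ennreal (max c 0 * v)" for c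
        using v(1) by (cases "0 \<le> c") (auto simp: ennreal_mult'[symmetric] ennreal_neg)
      from le2 have "p + max M 0 * v \<le> n + t + max (-M) 0 * v"
        unfolding p n real e using p(2) n(2) real(1) v(1)
        by (simp add: ennreal_plus[symmetric] ennreal_le_iff del: ennreal_plus)
      then have "(a + M) * v \<le> t"
        using a(2) v(1) by (auto simp: field_simps max_def split: if_splits)
      then show ?thesis
        using v(1) a(1) real by (auto simp: shift_pos_def ennreal_mult''[symmetric] intro!: ennreal_leI)
    qed
  qed
  then show "shift_pos M u x * emeasure lborel (ball x r) \<le> (\<integral>\<^sup>+z\<in>ball x r. shift_pos M u z \<partial>lebesgue)"
    by (simp add: v(2) T_def nn_set_integral_eq_lebesgue_on)
qed

lemma usc_on_less_open:
  assumes "open D" "usc_on D u" shows "open {z\<in>D. u z < a}"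
proof (subst open_subopen, clarify)
  fix z assume z: "z \<in> D" "u z < a"
  then have "\<forall>\<^sub>F y in at z within D. u y < a" using assms(2) by (auto simp: usc_on_def)
  then have "\<forall>\<^sub>F y in at z. u y < a"
    using assms(1) z(1) by (metis at_within_open)
  then obtain T where "open T" "z \<in> T" "\<forall>y\<in>T. y \<noteq> z \<longrightarrow> u y < a"
    by (auto simp: eventually_at_topological)
  then show "\<exists>T. open T \<and> z \<in> T \<and> T \<subseteq> {z\<in>D. u z < a}"
    using assms(1) z by (intro exI[of _ "T \<inter> D"]) auto
qed

lemma usc_on_measurable:
  fixes D :: "'a::euclidean_space set"
  assumes "open D" "usc_on D u" shows "u \<in> borel_measurable (lebesgue_on D)"
proof (rule borel_measurableI_less)
  fix a
  have "{z \<in> space (lebesgue_on D). u z < a} = {z\<in>D. u z < a}" by auto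
  moreover have "{z\<in>D. u z < a} \<in> sets lebesgue"
    using usc_on_less_open[OF assms, of a] by auto
  ultimately show "{z \<in> space (lebesgue_on D). u z < a} \<in> sets (lebesgue_on D)"
    using assms(1) by (auto simp: sets_restrict_space_iff)
qed

lemma usc_on_bounded_above:
  assumes "open D" "usc_on D u" "\<And>z. z \<in> D \<Longrightarrow> u z < \<infinity>" "compact K" "K \<subseteq> D"
  obtains L :: real where "0 \<le> L" "\<And>z. z \<in> K \<Longrightarrow> u z \<le> ereal L"
proof -
  have "K \<subseteq> (\<Union>n\<in>(UNIV::nat set). {z\<in>D. u z < ereal (real n)})"
  proof
    fix z assume "z \<in> K"
    then have "z \<in> D" "u z < \<infinity>" using assms by auto
    then obtain n :: nat where "u z < ereal (real n)" using less_PInf_Ex_of_nat by auto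
    then show "z \<in> (\<Union>n\<in>(UNIV::nat set). {z\<in>D. u z < ereal (real n)})" using \<open>z \<in> D\<close> by auto
  qed
  then obtain C where C: "finite C" "K \<subseteq> (\<Union>n\<in>C. {z\<in>D. u z < ereal (real n)})"
    using compactE_image[OF assms(4), of UNIV "\<lambda>n::nat. {z\<in>D. u z < ereal (real n)}"]
      usc_on_less_open[OF assms(1,2)] by metis
  show ?thesis
  proof (rule that[of "real (\<Sum>C)"])
    fix z assume "z \<in> K"
    then obtain n where n: "n \<in> C" "u z < ereal (real n)" using C by auto
    have "n \<le> \<Sum>C" using n(1) C(1) by (intro member_le_sum) auto
    then have "ereal (real n) \<le> ereal (real (\<Sum>C))" by (simp del: of_nat_sum)
    then show "u z \<le> ereal (real (\<Sum>C))" using n(2) by (meson less_le_trans less_imp_le)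
  qed (simp add: sum_nonneg)
qed

text \<open>
  Conversely, the inequalities for all \<open>(u + M)\<^sup>+\<close> give the one for \<open>u\<close>: since
  \<open>(u + k)\<^sup>+ = u\<^sup>+ + k - min u\<^sup>- k\<close>, they bound the integrals of \<open>min u\<^sup>- k\<close>, and monotone
  convergence in \<open>k\<close> yields the bound for the integral of \<open>u\<^sup>-\<close>.
\<close>
lemma sub_mean_value_on_shift_posI:
  fixes D :: "'a::euclidean_space set"
  assumes D: "open D" and usc: "usc_on D u" and fin: "\<And>z. z \<in> D \<Longrightarrow> u z < \<infinity>"
    and sm: "\<And>M. 0 \<le> M \<Longrightarrow> submean_on D (shift_pos M u)"
  shows "sub_mean_value_on D u"
  unfolding sub_mean_value_on_def
proof (intro allI impI, elim conjE)
  fix x :: 'a and r :: real assume r: "0 < r" and sub: "cball x r \<subseteq> D"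
  let ?B = "ball x r" and ?L = "lebesgue_on (ball x r)"
  define v where "v = measure lebesgue (ball (0::'a) 1) * r ^ DIM('a)"
  have v: "0 < v" "emeasure lborel ?B = ennreal v"
    using emeasure_ball_unit[OF r] by (auto simp: v_def)
  have [measurable]: "u \<in> borel_measurable ?L"
    using sub by (intro measurable_restrict_mono[OF usc_on_measurable[OF D usc]]) auto
  have const: "(\<integral>\<^sup>+z. ennreal c \<partial>?L) = ennreal c * ennreal v"
    "emeasure ?L ?B = ennreal v" for c
    using v(2) by (simp_all add: emeasure_restrict_space)
  define P where "P = (\<integral>\<^sup>+z. e2ennreal (u z) \<partial>?L)"
  define N where "N = (\<integral>\<^sup>+z. e2ennreal (- u z) \<partial>?L)"
  define m where "m = (\<lambda>k z. min (e2ennreal (- u z)) (ennreal (real k)))"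
  have [measurable]: "m k \<in> borel_measurable ?L" for k unfolding m_def by measurable
  obtain L where L: "0 \<le> L" "\<And>z. z \<in> cball x r \<Longrightarrow> u z \<le> ereal L"
    using usc_on_bounded_above[OF D usc fin _ sub] by auto
  have "P \<le> (\<integral>\<^sup>+z. ennreal L \<partial>?L)"
    unfolding P_def
  proof (rule nn_integral_mono)
    fix z assume "z \<in> space ?L"
    then have "u z \<le> ereal L" using L(2)[of z] by auto
    then show "e2ennreal (u z) \<le> ennreal L" using e2ennreal_mono[of "u z" "ereal L"] by simp
  qed
  then have "P < top" unfolding const by (auto simp: ennreal_mult_less_top intro: le_less_trans)
  then obtain p where p: "P = ennreal p" "0 \<le> p" by (cases P) auto
  have N: "N = (SUP k. integral\<^sup>N ?L (m k))"
  proof -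
    have "incseq m" unfolding incseq_def le_fun_def m_def
      by (intro allI impI min.mono order_refl ennreal_leI) simp
    moreover have "(SUP k. m k z) = e2ennreal (- u z)" for z
    proof -
      have "(SUP k. m k z) = min (e2ennreal (- u z)) (SUP k. ennreal (real k))"
        unfolding m_def by (simp add: inf_min[symmetric] inf_SUP)
      also have "(SUP k. ennreal (real k)) = top"
        by (metis SUP_cong ennreal_SUP_of_nat_eq_top ennreal_of_nat_eq_real_of_nat)
      finally show ?thesis by simp
    qed
    ultimately show ?thesis
      unfolding N_def using nn_integral_monotone_convergence_SUP[of m ?L] by simp
  qed
  show "u x \<le> ball_mean u x r"
  proof (cases "u x")
    case MInf then show ?thesis by simp
  next
    case PInf then show ?thesis using fin[of x] subsetD[OF sub, of x] r by auto
  next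
    case (real a)
    have e: "ennreal c * ennreal v = ennreal (max c 0 * v)" for c
      using v(1) by (cases "0 \<le> c") (auto simp: ennreal_mult'[symmetric] ennreal_neg)
    have key: "integral\<^sup>N ?L (m k) \<le> ennreal (p - a * v)" for k
    proof -
      have "(\<integral>\<^sup>+z. e2ennreal (u z) + ennreal (real k) \<partial>?L) = (\<integral>\<^sup>+z. shift_pos (real k) u z + m k z \<partial>?L)"
      proof (rule nn_integral_cong)
        fix z assume "z \<in> space ?L"
        then have "z \<in> D" using subsetD[OF sub, of z] by auto
        then have "u z < \<infinity>" by (rule fin)
        then show "e2ennreal (u z) + ennreal (real k) = shift_pos (real k) u z + m k z"
          unfolding shift_pos_def m_def
          by (cases "u z") (auto simp: ennreal_plus_if ennreal_neg e2ennreal_neg min_def ennreal_le_iff2 top_unique ennreal_of_nat_neq_top simp flip: ennreal_of_nat_eq_real_of_nat)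
      qed
      then have eq: "P + ennreal (real k) * ennreal v = integral\<^sup>N ?L (shift_pos (real k) u) + integral\<^sup>N ?L (m k)"
        unfolding P_def by (simp add: nn_integral_add const)
      have "shift_pos (real k) u x * emeasure lborel ?B \<le> integral\<^sup>N ?L (shift_pos (real k) u)"
        using sm[of "real k"] r sub unfolding submean_on_def by (simp add: nn_set_integral_eq_lebesgue_on)
      then have "ennreal (a + real k) * ennreal v \<le> integral\<^sup>N ?L (shift_pos (real k) u)"
        by (simp add: v shift_pos_def real)
      then have le: "ennreal (a + real k) * ennreal v + integral\<^sup>N ?L (m k) \<le> ennreal (p + real k * v)"
      proof -
        assume "ennreal (a + real k) * ennreal v \<le> integral\<^sup>N ?L (shift_pos (real k) u)"
        then have "ennreal (a + real k) * ennreal v + integral\<^sup>N ?L (m k) \<le> P + ennreal (real k) * ennreal v"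
          unfolding eq by (rule add_right_mono)
        also have "\<dots> = ennreal (p + real k * v)"
          using p v(1) unfolding p(1) e by simp
        finally show ?thesis .
      qed
      have "integral\<^sup>N ?L (m k) \<le> ennreal (a + real k) * ennreal v + integral\<^sup>N ?L (m k)"
        by simp
      also have "\<dots> < top" using le by (rule le_less_trans) simp
      finally have "integral\<^sup>N ?L (m k) < top" .
      then obtain q where q: "integral\<^sup>N ?L (m k) = ennreal q" "0 \<le> q" by (cases "integral\<^sup>N ?L (m k)") auto
      have "max 0 (a + real k) * v + q \<le> p + real k * v"
        using le p(2) q(2) v(1) unfolding q e
        by (simp add: ennreal_plus[symmetric] ennreal_le_iff max.commute del: ennreal_plus)
      moreover have "(a + real k) * v \<le> max 0 (a + real k) * v"
        using v(1) by (intro mult_right_mono) auto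
      ultimately have "q \<le> p - a * v" by (simp add: algebra_simps)
      then show ?thesis unfolding q by (rule ennreal_leI)
    qed
    have pa: "0 \<le> p - a * v"
    proof -
      have "shift_pos 0 u x * emeasure lborel ?B \<le> integral\<^sup>N ?L (shift_pos 0 u)"
        using sm[of 0] r sub unfolding submean_on_def by (simp add: nn_set_integral_eq_lebesgue_on)
      then have "ennreal a * ennreal v \<le> ennreal p"
        by (simp add: v p(1)[symmetric] P_def shift_pos_def[abs_def] real zero_ereal_def[symmetric])
      then have "max a 0 * v \<le> p" unfolding e using p(2) v(1) by (simp add: ennreal_le_iff)
      moreover have "a * v \<le> max a 0 * v" using v(1) by (intro mult_right_mono) auto
      ultimately show ?thesis by simp
    qed
    have "N \<le> ennreal (p - a * v)" unfolding N by (rule SUP_least) (rule key)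
    moreover from this obtain n where n: "N = ennreal n" "0 \<le> n" by (cases N) (auto simp: top_unique)
    ultimately have "n \<le> p - a * v" using pa by (simp add: ennreal_le_iff)
    then have "a \<le> (p - n) / v" using v(1) by (simp add: field_simps)
    then have "u x \<le> ereal (1 / v) * (enn2ereal P - enn2ereal N)"
      by (simp add: real p n)
    then show ?thesis
      by (simp add: ball_mean_eq nn_set_integral_eq_lebesgue_on P_def N_def v_def)
  qed
qed

section \<open>A mean value inequality for compositions\<close>

text \<open>
  The \<open>\<Delta>\<^sub>2\<close>-condition for the inverse of \<open>\<phi>\<close> says that \<open>\<phi>\<close> grows at least like a power: a bounded
  ratio of values of \<open>\<phi>\<close> forces a bounded ratio of arguments.
\<close>
lemma inverse_Delta2_growth:
  assumes mono: "strict_mono_on {0..} \<phi>" and surj: "\<phi> ` {0..} = {0..}"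
    and D: "Delta2 (inv_into {0..} \<phi>)"
  shows "\<exists>A\<ge>1. \<forall>s\<ge>0. \<forall>t\<ge>0. \<phi> s \<le> 2 ^ k * \<phi> t \<longrightarrow> s \<le> A * t"
proof -
  let ?\<psi> = "inv_into {0..} \<phi>"
  obtain C where C: "C \<ge> 1" "\<And>t. t \<ge> 0 \<Longrightarrow> ?\<psi> (2 * t) \<le> C * ?\<psi> t" using D unfolding Delta2_def by auto
  have inj: "inj_on \<phi> {0..}" using mono by (rule strict_mono_on_imp_inj_on)
  have id1: "?\<psi> (\<phi> t) = t" if "t \<ge> 0" for t using inj that by simp
  have id2: "\<phi> (?\<psi> t) = t" "?\<psi> t \<ge> 0" if "t \<ge> 0" for t
    using that surj f_inv_into_f[of t \<phi> "{0..}"] inv_into_into[of t \<phi> "{0..}"] by auto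
  have pw: "?\<psi> (2 ^ k * t) \<le> C ^ k * ?\<psi> t" if t: "t \<ge> 0" for t
  proof (induction k)
    case (Suc k)
    have "?\<psi> (2 ^ Suc k * t) \<le> C * ?\<psi> (2 ^ k * t)"
      using C(2)[of "2 ^ k * t"] t by (simp add: mult.assoc)
    also have "\<dots> \<le> C * (C ^ k * ?\<psi> t)" using Suc C by (intro mult_left_mono) auto
    finally show ?case by (simp add: mult.assoc)
  qed simp
  show ?thesis
  proof (intro exI[of _ "C ^ k"] conjI allI impI)
    show "C ^ k \<ge> 1" using C by simp
    fix s t :: real assume st: "0 \<le> s" "0 \<le> t" "\<phi> s \<le> 2 ^ k * \<phi> t"
    have "\<phi> t \<ge> 0" using surj st by auto
    then have "\<phi> s \<le> \<phi> (?\<psi> (2 ^ k * \<phi> t))" "?\<psi> (2 ^ k * \<phi> t) \<ge> 0" using st id2 by auto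
    then have "s \<le> ?\<psi> (2 ^ k * \<phi> t)"
      using strict_mono_on_leD[OF mono] mono st
      by (metis atLeast_iff not_le strict_mono_onD)
    also have "\<dots> \<le> C ^ k * t" using pw[of "\<phi> t"] \<open>\<phi> t \<ge> 0\<close> id1 st by simp
    finally show "s \<le> C ^ k * t" .
  qed
qed

lemma surj_strict_mono_zero:
  fixes \<phi> :: "real \<Rightarrow> real"
  assumes "strict_mono_on {0..} \<phi>" and "\<phi> ` {0..} = {0..}"
  shows "\<phi> 0 = 0"
proof -
  obtain s where s: "s \<ge> 0" "\<phi> s = 0" using assms(2) by (metis atLeast_iff imageE order_refl)
  have "\<phi> 0 \<ge> 0" using assms(2) by auto
  moreover have "\<phi> 0 \<le> \<phi> s" using strict_mono_on_leD[OF assms(1), of 0 s] s by simp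
  ultimately show ?thesis using s by simp
qed

text \<open>
  A mean value inequality with a constant for \<open>\<phi> \<circ> v\<close>, although \<open>\<phi>\<close> may be concave. Let \<open>z1\<close>
  nearly maximise \<open>F z = (r - dist z0 z)^N * \<phi> (v z)\<close> on the ball and let \<open>\<delta>\<close> be half its distance to
  the boundary. On \<open>cball z1 \<delta>\<close> the values of \<open>\<phi> \<circ> v\<close> are at most \<open>2 ^ (N + 1)\<close> times that at
  \<open>z1\<close>, hence \<open>v \<le> A * v z1\<close> there; as \<open>\<phi> t / t\<close> is quasi-decreasing, \<open>v\<close> is dominated on
  \<open>cball z1 \<delta>\<close> by a multiple of \<open>\<phi> \<circ> v\<close>, and the sub-mean value property of \<open>v\<close> at \<open>z1\<close>
  bounds \<open>F z1\<close>, hence \<open>F z0\<close>. Boundedness of \<open>v\<close> is only used to make the supremum finite: the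
  constant does not depend on the bound. The integrand is replaced by a measurable almost everywhere
  majorant \<open>G\<close>, so that \<open>\<phi> \<circ> v\<close> itself need not be measurable.
\<close>
lemma quasi_mean_value:
  fixes \<phi> :: "real \<Rightarrow> real"
  assumes smono: "strict_mono_on {0..} \<phi>" and surj: "\<phi> ` {0..} = {0..}"
    and D2: "Delta2 (inv_into {0..} \<phi>)"
    and C: "0 < C" and quasi: "\<forall>s t. 0 < s \<and> s \<le> t \<longrightarrow> \<phi> s / s \<ge> C * (\<phi> t / t)"
  obtains K where "0 < K"
    "\<And>(v::'a::euclidean_space \<Rightarrow> real) z0 r L G. 0 < r \<Longrightarrow>
       (\<And>z. z \<in> ball z0 r \<Longrightarrow> 0 \<le> v z \<and> v z \<le> L) \<Longrightarrow>
       submean_on (ball z0 r) (\<lambda>z. ennreal (v z)) \<Longrightarrow>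
       G \<in> borel_measurable lebesgue \<Longrightarrow>
       AE z in lebesgue. z \<in> ball z0 r \<longrightarrow> ennreal (\<phi> (v z)) \<le> G z \<Longrightarrow>
       ennreal (\<phi> (v z0)) * emeasure lborel (ball z0 r) \<le> ennreal K * (\<integral>\<^sup>+z\<in>ball z0 r. G z \<partial>lebesgue)"
proof -
  let ?N = "DIM('a)"
  obtain A where A: "A \<ge> 1" and Ag: "\<And>s t. 0 \<le> s \<Longrightarrow> 0 \<le> t \<Longrightarrow> \<phi> s \<le> 2 ^ (?N + 1) * \<phi> t \<Longrightarrow> s \<le> A * t"
    using inverse_Delta2_growth[OF smono surj D2, of "?N + 1"] by blast
  have zero: "\<phi> 0 = 0" using smono surj by (rule surj_strict_mono_zero)
  have mono: "\<phi> s \<le> \<phi> t" if "0 \<le> s" "s \<le> t" for s t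
    using strict_mono_on_leD[OF smono] that by simp
  define \<nu> where "\<nu> = measure lebesgue (ball (0::'a) 1)"
  have \<nu>: "emeasure lborel (ball x r) = ennreal (\<nu> * r ^ ?N)" "0 < \<nu>" if "0 < r" for x :: 'a and r
    using emeasure_ball_unit(1)[OF that, of x] emeasure_ball_unit(2)[OF zero_less_one, where 'a='a] by (auto simp: \<nu>_def)
  define K where "K = 2 ^ (?N + 1) * A / C"
  have K: "K > 0" using A C by (simp add: K_def)
  have nn: "0 \<le> \<phi> t" if "0 \<le> t" for t using mono[of 0 t] zero that by simp
  show ?thesis
  proof (rule that[OF K])
    fix v :: "'a \<Rightarrow> real" and z0 :: 'a and r L :: real and G :: "'a \<Rightarrow> ennreal"
    assume r: "0 < r" and v: "\<And>z. z \<in> ball z0 r \<Longrightarrow> 0 \<le> v z \<and> v z \<le> L"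
      and sm: "submean_on (ball z0 r) (\<lambda>z. ennreal (v z))"
      and [measurable]: "G \<in> borel_measurable lebesgue"
      and G: "AE z in lebesgue. z \<in> ball z0 r \<longrightarrow> ennreal (\<phi> (v z)) \<le> G z"
    define I where "I = (\<integral>\<^sup>+z\<in>ball z0 r. G z \<partial>lebesgue)"
    define F where "F = (\<lambda>z. (r - dist z0 z) ^ ?N * \<phi> (v z))"
    have z0: "z0 \<in> ball z0 r" using r by simp
    show "ennreal (\<phi> (v z0)) * emeasure lborel (ball z0 r) \<le> ennreal K * (\<integral>\<^sup>+z\<in>ball z0 r. G z \<partial>lebesgue)"
    proof (cases "\<phi> (v z0) = 0 \<or> I = top")
      case True
      then show ?thesis using K by (auto simp: I_def[symmetric] ennreal_mult_top)
    next
      case False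
      then obtain i where i: "I = ennreal i" "0 \<le> i" by (cases I) auto
      have Fle: "F z \<le> r ^ ?N * \<phi> L" if "z \<in> ball z0 r" for z
        unfolding F_def using that v nn mono r
        by (intro mult_mono power_mono) auto
      have bdd: "bdd_above (F ` ball z0 r)" using Fle by (rule bdd_aboveI2)
      define S where "S = Sup (F ` ball z0 r)"
      have FS: "F z \<le> S" if "z \<in> ball z0 r" for z
        unfolding S_def using that bdd by (intro cSup_upper) auto
      have Fz0: "F z0 = r ^ ?N * \<phi> (v z0)" "F z0 > 0"
        using False nn[of "v z0"] v z0 r by (auto simp: F_def)
      then have "S > 0" using FS[OF z0] by simp
      then have "S / 2 < S" by simp
      moreover have "F ` ball z0 r \<noteq> {}" using z0 by blast
      ultimately have "\<exists>x\<in>F ` ball z0 r. S / 2 < x"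
        using less_cSup_iff[OF _ bdd] unfolding S_def by blast
      then obtain z1 where z1: "z1 \<in> ball z0 r" "S / 2 < F z1" by blast
      define \<delta> where "\<delta> = (r - dist z0 z1) / 2"
      have \<delta>: "\<delta> > 0" using z1 by (simp add: \<delta>_def)
      have "r - dist z0 z1 = 2 * \<delta>" by (simp add: \<delta>_def)
      then have F1: "F z1 = 2 ^ ?N * \<delta> ^ ?N * \<phi> (v z1)"
        by (simp add: F_def power_mult_distrib)
      have v1: "0 \<le> v z1" using v z1 by auto
      have "F z1 > 0" using z1 \<open>S > 0\<close> by simp
      then have p1: "\<phi> (v z1) > 0" using nn[OF v1] by (cases "\<phi> (v z1) = 0") (auto simp: F1)
      then have v1p: "v z1 > 0" using v1 zero by (cases "v z1 = 0") auto
      have near: "z \<in> ball z0 r \<and> \<delta> \<le> r - dist z0 z" if "z \<in> cball z1 \<delta>" for z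
        using that dist_triangle[of z0 z z1] \<delta> by (auto simp: \<delta>_def dist_commute field_simps)
      define c where "c = A * v z1 / (C * \<phi> (v z1))"
      have c: "c > 0" using A v1p C p1 by (simp add: c_def)
      have vc: "v z \<le> c * \<phi> (v z)" if z: "z \<in> cball z1 \<delta>" for z
      proof (cases "v z = 0")
        case True then show ?thesis using zero by simp
      next
        case False
        have zb: "z \<in> ball z0 r" "\<delta> \<le> r - dist z0 z" using near[OF z] by auto
        then have vz: "v z > 0" using v False by force
        have "\<delta> ^ ?N * \<phi> (v z) \<le> F z" unfolding F_def
          using \<delta> zb nn[of "v z"] vz by (intro mult_right_mono power_mono) auto
        also have "\<dots> \<le> 2 * F z1" using FS[OF zb(1)] z1 by simp
        also have "\<dots> = \<delta> ^ ?N * (2 ^ (?N + 1) * \<phi> (v z1))" by (simp add: F1)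
        finally have "\<phi> (v z) \<le> 2 ^ (?N + 1) * \<phi> (v z1)" using \<delta> by simp
        then have vA: "v z \<le> A * v z1" using Ag[of "v z" "v z1"] vz v1 by simp
        have "C * \<phi> (v z1) / (A * v z1) \<le> C * (\<phi> (A * v z1) / (A * v z1))"
          using C A v1p mono[of "v z1" "A * v z1"]
          by (auto intro!: divide_right_mono mult_left_mono)
        also have "\<dots> \<le> \<phi> (v z) / v z" using quasi vz vA by blast
        finally show ?thesis using vz C A v1p p1 by (simp add: c_def field_simps)
      qed
      have sub: "cball z1 \<delta> \<subseteq> ball z0 r" using near by auto
      have "ennreal (v z1) * ennreal (\<nu> * \<delta> ^ ?N) \<le> (\<integral>\<^sup>+z\<in>ball z1 \<delta>. ennreal (v z) \<partial>lebesgue)"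
        using sm \<delta> sub \<nu>(1)[OF \<delta>] unfolding submean_on_def by metis
      also have "\<dots> \<le> (\<integral>\<^sup>+z. ennreal c * (G z * indicator (ball z0 r) z) \<partial>lebesgue)"
      proof (rule nn_integral_mono_AE, use G in eventually_elim)
        case (elim z)
        show ?case
        proof (cases "z \<in> ball z1 \<delta>")
          case True
          then have "z \<in> cball z1 \<delta>" by simp
          with sub have zz: "z \<in> cball z1 \<delta>" "z \<in> ball z0 r" by blast+
          have "ennreal (v z) \<le> ennreal c * ennreal (\<phi> (v z))"
            using vc[OF zz(1)] c nn v zz by (subst ennreal_mult[symmetric]) (auto intro!: ennreal_leI)
          also have "\<dots> \<le> ennreal c * G z" using elim zz by (intro mult_left_mono) auto
          finally show ?thesis using zz True by simp
        qed simp
      qed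
      also have "\<dots> = ennreal c * I" unfolding I_def
        by (intro nn_integral_cmult borel_measurable_times_ennreal borel_measurable_indicator) auto
      finally have "v z1 * (\<nu> * \<delta> ^ ?N) \<le> c * i"
        unfolding i using v1 c i \<nu>(2)[OF r] \<delta> by (simp add: ennreal_mult[symmetric] ennreal_le_iff)
      then have le: "\<phi> (v z1) * (\<nu> * \<delta> ^ ?N) \<le> A / C * i"
        using p1 v1p C A by (simp add: c_def field_simps)
      have "\<phi> (v z0) * (\<nu> * r ^ ?N) = \<nu> * F z0" by (simp add: Fz0)
      also have "\<dots> \<le> \<nu> * (2 * F z1)" using FS[OF z0] z1 \<nu>(2)[OF r] by (intro mult_left_mono) auto
      also have "\<dots> = 2 ^ (?N + 1) * (\<phi> (v z1) * (\<nu> * \<delta> ^ ?N))" by (simp add: F1)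
      also have "\<dots> \<le> 2 ^ (?N + 1) * (A / C * i)" using le by (intro mult_left_mono) auto
      also have "\<dots> = K * i" by (simp add: K_def)
      finally show ?thesis
        unfolding I_def[symmetric] i \<nu>(1)[OF r] using K i nn[of "v z0"] v z0 \<nu>(2)[OF r] r
        by (simp add: ennreal_mult[symmetric] ennreal_le_iff)
    qed
  qed
qed

section \<open>Local boundedness from above\<close>

lemma submean_on_subset: "submean_on D f \<Longrightarrow> E \<subseteq> D \<Longrightarrow> submean_on E f"
  unfolding submean_on_def by (meson order_trans)

lemma submean_on_cong:
  assumes "submean_on D f" and eq: "\<And>z. z \<in> D \<Longrightarrow> f z = g z"
  shows "submean_on D g"
  unfolding submean_on_def
proof (intro allI impI, elim conjE)
  fix x r assume r: "0 < r" "cball x r \<subseteq> D"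
  then have "x \<in> D" "ball x r \<subseteq> D" using ball_subset_cball[of x r] by auto
  then have "(\<integral>\<^sup>+z\<in>ball x r. f z \<partial>lebesgue) = (\<integral>\<^sup>+z\<in>ball x r. g z \<partial>lebesgue)"
    using eq by (intro nn_integral_cong) (auto split: split_indicator)
  then show "g x * emeasure lborel (ball x r) \<le> (\<integral>\<^sup>+z\<in>ball x r. g z \<partial>lebesgue)"
    using assms r eq[OF \<open>x \<in> D\<close>] unfolding submean_on_def by metis
qed

lemma submean_on_cmult:
  assumes sm: "submean_on D f" and f: "f \<in> borel_measurable (lebesgue_on D)"
  shows "submean_on D (\<lambda>z. c * f z)"
  unfolding submean_on_def
proof (intro allI impI, elim conjE)
  fix x r assume r: "0 < r" "cball x r \<subseteq> D"
  have [measurable]: "f \<in> borel_measurable (lebesgue_on (ball x r))"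
    using r ball_subset_cball[of x r] by (intro measurable_restrict_mono[OF f]) auto
  have "c * f x * emeasure lborel (ball x r) \<le> c * (\<integral>\<^sup>+z\<in>ball x r. f z \<partial>lebesgue)"
    using sm r unfolding submean_on_def by (simp add: mult.assoc mult_left_mono)
  also have "\<dots> = (\<integral>\<^sup>+z\<in>ball x r. c * f z \<partial>lebesgue)"
    by (simp add: nn_set_integral_eq_lebesgue_on nn_integral_cmult)
  finally show "c * f x * emeasure lborel (ball x r) \<le> (\<integral>\<^sup>+z\<in>ball x r. c * f z \<partial>lebesgue)" .
qed

text \<open>The inner function of a permissible function only enters through this minorant.\<close>
lemma convex_mono_linear_minorant:
  fixes f :: "real \<Rightarrow> real"
  assumes cv: "convex_on {0..} f" and m: "mono_on {0..} f" and nn: "\<And>t. 0 \<le> t \<Longrightarrow> 0 \<le> f t"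
    and nc: "\<not> f constant_on {0..}"
  obtains a s where "0 < a" "0 \<le> s" "\<And>t. 0 \<le> t \<Longrightarrow> a * max (t - s) 0 \<le> f t"
proof -
  obtain s1 where s1: "0 \<le> s1" "f s1 \<noteq> f 0" using nc unfolding constant_on_def by force
  have lt: "f 0 < f s1" using mono_onD[OF m, of 0 s1] s1 by simp
  then have s1p: "0 < s1" using s1 by (cases "s1 = 0") auto
  define a where "a = (f s1 - f 0) / s1"
  show ?thesis
  proof (rule that[of a s1])
    show "0 < a" "0 \<le> s1" using lt s1p by (auto simp: a_def)
    fix t :: real assume t: "0 \<le> t"
    show "a * max (t - s1) 0 \<le> f t"
    proof (cases "t \<le> s1")
      case True then show ?thesis using nn[OF t] by simp
    next
      case False
      then have ts: "s1 < t" by simp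
      have "f ((1 - s1 / t) *\<^sub>R 0 + (s1 / t) *\<^sub>R t) \<le> (1 - s1 / t) * f 0 + (s1 / t) * f t"
        using ts s1p by (intro convex_onD[OF cv]) auto
      then have "f s1 \<le> (1 - s1 / t) * f 0 + (s1 / t) * f t" using ts s1p by simp
      then have "f s1 - f 0 \<le> s1 / t * (f t - f 0)" by (simp add: algebra_simps)
      then have "a * t \<le> f t - f 0" using ts s1p by (simp add: a_def field_simps)
      moreover have "0 \<le> f 0" "0 \<le> a * s1" using nn[of 0] lt s1p by (auto simp: a_def)
      ultimately have "a * (t - s1) \<le> f t" by (simp add: algebra_simps)
      then show ?thesis using ts by simp
    qed
  qed
qed

text \<open>
  Replacing a Lebesgue measurable function by a Borel majorant with the same integral avoids null-set
  bookkeeping when Tonelli's theorem is applied.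
\<close>
lemma borel_majorant:
  fixes f :: "'a::euclidean_space \<Rightarrow> real"
  assumes f: "f \<in> borel_measurable lebesgue"
  obtains g :: "'a \<Rightarrow> ennreal" where "g \<in> borel_measurable borel" "\<And>z. ennreal (f z) \<le> g z"
    "(\<integral>\<^sup>+z. g z \<partial>lborel) = (\<integral>\<^sup>+z. ennreal (f z) \<partial>lebesgue)"
proof -
  obtain g' where g': "g' \<in> borel_measurable lborel" "AE x in lborel. f x = g' x"
    using completion_ex_borel_measurable_real[OF f] by auto
  obtain N where N: "\<And>x. x \<in> space lborel - N \<Longrightarrow> f x = g' x" "N \<in> null_sets lborel"
    using AE_E3[OF g'(2)] by metis
  have [measurable]: "N \<in> sets borel" "g' \<in> borel_measurable borel" using N g' by auto
  define g where "g = (\<lambda>z. if z \<in> N then top else ennreal (g' z))"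
  have AE_N: "AE z in lborel. z \<notin> N" using N(2) by (rule AE_not_in)
  show ?thesis
  proof (rule that[of g])
    show "g \<in> borel_measurable borel" unfolding g_def by measurable
    show "ennreal (f z) \<le> g z" for z using N(1)[of z] by (auto simp: g_def)
    have "(\<integral>\<^sup>+z. g z \<partial>lborel) = (\<integral>\<^sup>+z. ennreal (f z) \<partial>lborel)"
      using AE_N g'(2) by (intro nn_integral_cong_AE) (auto simp: g_def elim: eventually_elim2)
    then show "(\<integral>\<^sup>+z. g z \<partial>lborel) = (\<integral>\<^sup>+z. ennreal (f z) \<partial>lebesgue)"
      by (simp add: nn_integral_completion)
  qed
qed

lemma ennreal_pos_part:
  assumes "u z < \<infinity>" shows "ennreal (pos_part u z) = e2ennreal (u z)"
  using assms unfolding pos_part_def by (cases "u z") (auto simp: max_def ennreal_neg e2ennreal_neg)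

lemma enn2real_shift_pos:
  assumes "u z < \<infinity>" "0 \<le> s"
  shows "enn2real (shift_pos (- s) u z) = max (pos_part u z - s) 0"
  using assms unfolding pos_part_def shift_pos_def
  by (cases "u z") (auto simp: max_def ennreal_neg e2ennreal_neg)

lemma pos_part_nonneg: "0 \<le> pos_part u z"
  unfolding pos_part_def by (simp add: real_of_ereal_pos)

lemma cball_Times_subset_cball:
  "cball x r \<times> cball y s \<subseteq> cball (x, y) (r + s)"
proof clarify
  fix a b assume "a \<in> cball x r" "b \<in> cball y s"
  then have "dist x a + dist y b \<le> r + s" by simp
  moreover have "dist (x, y) (a, b) \<le> dist x a + dist y b"
    unfolding dist_Pair_Pair by (intro sqrt_sum_squares_le_sum) auto
  ultimately show "(a, b) \<in> cball (x, y) (r + s)" by simp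
qed

lemma slice_open:
  assumes "open \<Omega>"
  shows "open {x. (x, y) \<in> \<Omega>}" "open {y. (x, y) \<in> \<Omega>}"
proof -
  have "open ((\<lambda>x. (x, y)) -` \<Omega>)" "open ((\<lambda>y. (x, y)) -` \<Omega>)"
    using assms by (intro open_vimage continuous_intros; simp)+
  then show "open {x. (x, y) \<in> \<Omega>}" "open {y. (x, y) \<in> \<Omega>}"
    by (simp_all add: vimage_def)
qed

text \<open>
  The mean over a ball of fixed radius is at most a fixed multiple of the integral over a larger
  ball.
\<close>
lemma nearly_subharmonic_bounded:
  fixes D :: "'a::euclidean_space set"
  assumes ns: "nearly_subharmonic_on D u" and r: "0 < r" and sub: "cball x0 (2 * r) \<subseteq> D"
  obtains L where "0 \<le> L" "\<And>z. z \<in> ball x0 r \<Longrightarrow> pos_part u z \<le> L"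
proof -
  have fin: "\<And>z. z \<in> D \<Longrightarrow> u z < \<infinity>" and sm: "submean_on D (shift_pos 0 u)"
    using ns submean_on_shift_pos unfolding nearly_subharmonic_on_def by auto
  have "set_integrable lebesgue (cball x0 (2 * r)) (pos_part u)"
    using ns sub unfolding nearly_subharmonic_on_def locally_integrable_on_def by auto
  then have "(\<integral>\<^sup>+z. ennreal (norm (indicator (cball x0 (2 * r)) z *\<^sub>R pos_part u z)) \<partial>lebesgue) < \<infinity>"
    unfolding set_integrable_def integrable_iff_bounded by auto
  also have "(\<integral>\<^sup>+z. ennreal (norm (indicator (cball x0 (2 * r)) z *\<^sub>R pos_part u z)) \<partial>lebesgue)
      = (\<integral>\<^sup>+z\<in>cball x0 (2 * r). ennreal (pos_part u z) \<partial>lebesgue)"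
    by (intro nn_integral_cong) (auto simp: pos_part_nonneg split: split_indicator)
  finally obtain J where J: "(\<integral>\<^sup>+z\<in>cball x0 (2 * r). ennreal (pos_part u z) \<partial>lebesgue) = ennreal J" "0 \<le> J"
    by (cases "(\<integral>\<^sup>+z\<in>cball x0 (2 * r). ennreal (pos_part u z) \<partial>lebesgue)") auto
  define \<beta> where "\<beta> = measure lebesgue (ball (0::'a) 1) * r ^ DIM('a)"
  have \<beta>: "0 < \<beta>" "emeasure lborel (ball x r) = ennreal \<beta>" for x :: 'a
    using emeasure_ball_unit[OF r] by (auto simp: \<beta>_def)
  show ?thesis
  proof (rule that[of "J / \<beta>"])
    show "0 \<le> J / \<beta>" using J \<beta> by simp
    fix z assume z: "z \<in> ball x0 r"
    have cb: "cball z r \<subseteq> cball x0 (2 * r)" using z by (auto simp: subset_iff) (metis dist_commute dist_triangle_le add_mono less_imp_le mult_2)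
    moreover have "z \<in> cball z r" using r by simp
    ultimately have "z \<in> D" using sub by blast
    have bl: "ball z r \<subseteq> cball x0 (2 * r)" using cb ball_subset_cball[of z r] by auto
    have eq: "shift_pos 0 u w = ennreal (pos_part u w)" if "w \<in> D" for w
      using ennreal_pos_part[of u w] fin[OF that] by (simp add: shift_pos_def zero_ereal_def[symmetric])
    have "ennreal (pos_part u z) * ennreal \<beta> \<le> (\<integral>\<^sup>+w\<in>ball z r. shift_pos 0 u w \<partial>lebesgue)"
      using sm r cb sub eq[OF \<open>z \<in> D\<close>] \<beta>(2)[of z] unfolding submean_on_def by (metis order_trans)
    also have "\<dots> \<le> (\<integral>\<^sup>+z\<in>cball x0 (2 * r). ennreal (pos_part u z) \<partial>lebesgue)"
      using bl sub eq by (intro nn_integral_mono) (auto split: split_indicator)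
    finally have "pos_part u z * \<beta> \<le> J"
      using \<beta>(1) J pos_part_nonneg[of u z] by (simp add: ennreal_mult[symmetric] ennreal_le_iff)
    then show "pos_part u z \<le> J / \<beta>" using \<beta> by (simp add: field_simps)
  qed
qed

lemma ennreal_mult_le_divide:
  assumes "ennreal p * ennreal \<beta> \<le> ennreal k * J" "0 < \<beta>" "0 \<le> k" "0 \<le> p"
  shows "ennreal p \<le> ennreal (k / \<beta>) * J"
proof -
  have "ennreal (1 / \<beta>) * (ennreal p * ennreal \<beta>) \<le> ennreal (1 / \<beta>) * (ennreal k * J)"
    using assms(1) by (rule mult_left_mono) simp
  moreover have "ennreal (1 / \<beta>) * (ennreal p * ennreal \<beta>) = ennreal p"
    using assms by (simp add: ennreal_mult[symmetric])
  moreover have "ennreal (1 / \<beta>) * (ennreal k * J) = ennreal (k / \<beta>) * J"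
    using assms by (simp add: mult.assoc[symmetric] ennreal_mult[symmetric])
  ultimately show ?thesis by simp
qed

text \<open>
  With \<open>v = a * (u - s)\<^sup>+\<close> one has \<open>\<phi> \<circ> v \<le> \<psi> \<circ> u\<^sup>+\<close>. Applying the quasi mean value inequality in
  \<open>y\<close> for almost every \<open>x\<close> and then in \<open>x\<close> for the given \<open>y0\<close> bounds \<open>\<phi> (v (x0, y0))\<close> by a
  multiple of the integral of \<open>\<psi> \<circ> u\<^sup>+\<close> over a compact neighbourhood of \<open>K\<close>, uniformly in
  \<open>(x0, y0) \<in> K\<close>.
\<close>
lemma locally_bounded_above:
  fixes \<Omega> :: "('a::euclidean_space \<times> 'b::euclidean_space) set" and u :: "'a \<times> 'b \<Rightarrow> ereal"
  assumes \<Omega>: "open \<Omega>" and fin: "\<And>z. z \<in> \<Omega> \<Longrightarrow> u z < \<infinity>"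
    and ns: "\<And>y. nearly_subharmonic_on {x. (x, y) \<in> \<Omega>} (\<lambda>x. u (x, y))"
    and sh: "AE x in lebesgue. subharmonic_on {y. (x, y) \<in> \<Omega>} (\<lambda>y. u (x, y))"
    and perm: "permissible \<psi>" and nc: "\<not> \<psi> constant_on {0..}"
    and li: "locally_integrable_on \<Omega> (\<lambda>z. \<psi> (pos_part u z))"
    and K: "compact K" "K \<subseteq> \<Omega>"
  obtains L where "\<And>z. z \<in> K \<Longrightarrow> u z \<le> ereal L"
proof -
  obtain \<psi>1 \<phi> C where \<psi>1: "\<psi>1 \<in> {0..} \<rightarrow> {0..}" "mono_on {0..} \<psi>1" "convex_on {0..} \<psi>1"
    and \<phi>: "strict_mono_on {0..} \<phi>" "\<phi> ` {0..} = {0..}" "Delta2 (inv_into {0..} \<phi>)"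
    and \<psi>: "\<And>t. t \<ge> 0 \<Longrightarrow> \<psi> t = \<phi> (\<psi>1 t)"
    and C: "C > 0" "\<forall>s t. 0 < s \<and> s \<le> t \<longrightarrow> \<phi> s / s \<ge> C * (\<phi> t / t)"
    using perm unfolding permissible_def by blast
  have \<psi>1nn: "0 \<le> \<psi>1 t" if "0 \<le> t" for t using \<psi>1(1) that by auto
  have \<phi>mono: "\<phi> s \<le> \<phi> t" if "0 \<le> s" "s \<le> t" for s t
    using strict_mono_on_leD[OF \<phi>(1)] that by simp
  have \<phi>nn: "0 \<le> \<phi> t" if "0 \<le> t" for t using \<phi>(2) that by auto
  have "\<not> \<psi>1 constant_on {0..}"
  proof
    assume "\<psi>1 constant_on {0..}"
    then have "\<psi> constant_on {0..}" unfolding constant_on_def using \<psi> by (metis atLeast_iff)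
    with nc show False ..
  qed
  then obtain a s where a: "0 < a" "0 \<le> s" "\<And>t. 0 \<le> t \<Longrightarrow> a * max (t - s) 0 \<le> \<psi>1 t"
    using convex_mono_linear_minorant[OF \<psi>1(3,2) \<psi>1nn] by metis
  define v where "v = (\<lambda>z. a * enn2real (shift_pos (- s) u z))"
  have v0: "0 \<le> v z" for z using a by (simp add: v_def)
  have v_eq: "v z = a * max (pos_part u z - s) 0" if "z \<in> \<Omega>" for z
    using enn2real_shift_pos[of u z s] fin[OF that] a(2) by (simp add: v_def)
  have v_enn: "ennreal (v z) = ennreal a * shift_pos (- s) u z" if "z \<in> \<Omega>" for z
    using shift_pos_less_top[of u z "- s"] fin[OF that] a by (simp add: v_def ennreal_mult)
  have v\<psi>: "\<phi> (v z) \<le> \<psi> (pos_part u z)" if "z \<in> \<Omega>" for z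
    unfolding \<psi>[OF pos_part_nonneg] v_eq[OF that]
    using a pos_part_nonneg[of u z] by (intro \<phi>mono a(3)) auto

  \<comment> \<open>\<open>K'\<close> is a compact neighbourhood of \<open>K\<close> inside the domain.\<close>
  obtain e where e: "0 < e" "(\<Union>x\<in>K. cball x e) \<subseteq> \<Omega>"
    using compact_subset_open_imp_cball_epsilon_subset[OF K(1) \<Omega> K(2)] by auto
  define K' where "K' = (\<Union>x\<in>K. cball x e)"
  have K': "compact K'" "K' \<subseteq> \<Omega>"
    using compact_minkowski_sum_cball[OF K(1)] e by (auto simp: K'_def)
  define f where "f = (\<lambda>z. indicator K' z *\<^sub>R \<psi> (pos_part u z))"
  have fi: "integrable lebesgue f"
    using li K' unfolding locally_integrable_on_def set_integrable_def f_def by auto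
  have \<psi>nn: "0 \<le> \<psi> (pos_part u z)" for z
    using \<psi> \<psi>1nn \<phi>nn pos_part_nonneg[of u z] by simp
  have fnn: "0 \<le> f z" for z using \<psi>nn by (auto simp: f_def split: split_indicator)
  obtain g where g[measurable]: "g \<in> borel_measurable borel" and gf: "\<And>z. ennreal (f z) \<le> g z"
    and gi: "(\<integral>\<^sup>+z. g z \<partial>lborel) = (\<integral>\<^sup>+z. ennreal (f z) \<partial>lebesgue)"
    using borel_majorant[of f] fi by auto
  have "(\<integral>\<^sup>+z. ennreal (f z) \<partial>lebesgue) < \<infinity>" using fi fnn unfolding integrable_iff_bounded by simp
  then have "(\<integral>\<^sup>+z. g z \<partial>lborel) < \<infinity>" by (simp only: gi)
  then obtain J where J: "(\<integral>\<^sup>+z. g z \<partial>lborel) = ennreal J" "0 \<le> J"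
    by (cases "\<integral>\<^sup>+z. g z \<partial>lborel") auto
  have vg: "ennreal (\<phi> (v z)) \<le> g z" if "z \<in> K'" for z
  proof -
    have "ennreal (\<phi> (v z)) \<le> ennreal (f z)"
      using v\<psi>[of z] that K' by (auto simp: f_def intro!: ennreal_leI)
    then show ?thesis using gf order_trans by blast
  qed

  obtain K1 where K1: "0 < K1" "\<And>(v::'b \<Rightarrow> real) z0 r L G. 0 < r \<Longrightarrow>
       (\<And>z. z \<in> ball z0 r \<Longrightarrow> 0 \<le> v z \<and> v z \<le> L) \<Longrightarrow>
       submean_on (ball z0 r) (\<lambda>z. ennreal (v z)) \<Longrightarrow>
       G \<in> borel_measurable lebesgue \<Longrightarrow>
       AE z in lebesgue. z \<in> ball z0 r \<longrightarrow> ennreal (\<phi> (v z)) \<le> G z \<Longrightarrow>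
       ennreal (\<phi> (v z0)) * emeasure lborel (ball z0 r) \<le> ennreal K1 * (\<integral>\<^sup>+z\<in>ball z0 r. G z \<partial>lebesgue)"
  proof (rule quasi_mean_value[OF \<phi> C, where 'a='b], goal_cases)
    case (1 K)
    from 1(2,3) show ?case by (rule that)
  qed
  obtain K2 where K2: "0 < K2" "\<And>(v::'a \<Rightarrow> real) z0 r L G. 0 < r \<Longrightarrow>
       (\<And>z. z \<in> ball z0 r \<Longrightarrow> 0 \<le> v z \<and> v z \<le> L) \<Longrightarrow>
       submean_on (ball z0 r) (\<lambda>z. ennreal (v z)) \<Longrightarrow>
       G \<in> borel_measurable lebesgue \<Longrightarrow>
       AE z in lebesgue. z \<in> ball z0 r \<longrightarrow> ennreal (\<phi> (v z)) \<le> G z \<Longrightarrow>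
       ennreal (\<phi> (v z0)) * emeasure lborel (ball z0 r) \<le> ennreal K2 * (\<integral>\<^sup>+z\<in>ball z0 r. G z \<partial>lebesgue)"
  proof (rule quasi_mean_value[OF \<phi> C, where 'a='a], goal_cases)
    case (1 K)
    from 1(2,3) show ?case by (rule that)
  qed
  \<comment> \<open>Boxes of half-widths \<open>2 * r\<close> around points of \<open>K\<close> must stay inside \<open>K'\<close>.\<close>
  define r where "r = e / 4"
  have r: "0 < r" using e by (simp add: r_def)
  define \<beta>1 where "\<beta>1 = measure lebesgue (ball (0::'b) 1) * r ^ DIM('b)"
  define \<beta>2 where "\<beta>2 = measure lebesgue (ball (0::'a) 1) * r ^ DIM('a)"
  have \<beta>1: "0 < \<beta>1" "\<And>y::'b. emeasure lborel (ball y r) = ennreal \<beta>1"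
    using emeasure_ball_unit[OF r] by (auto simp: \<beta>1_def)
  have \<beta>2: "0 < \<beta>2" "\<And>x::'a. emeasure lborel (ball x r) = ennreal \<beta>2"
    using emeasure_ball_unit[OF r] by (auto simp: \<beta>2_def)

  define B where "B = K2 / \<beta>2 * (K1 / \<beta>1 * J)"
  have bound: "\<phi> (v (x0, y0)) \<le> B" if z0: "(x0, y0) \<in> K" for x0 y0
  proof -
    have box: "cball x0 (2 * r) \<times> cball y0 (2 * r) \<subseteq> K'"
      using cball_Times_subset_cball[of x0 "2 * r" y0 "2 * r"] z0 by (force simp: K'_def r_def)
    have xin: "cball x0 (2 * r) \<subseteq> {x. (x, y0) \<in> \<Omega>}"
    proof -
      have "y0 \<in> cball y0 (2 * r)" using r by simp
      then show ?thesis using box K'(2) by blast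
    qed
    have yin: "cball y0 r \<subseteq> {y. (x, y) \<in> \<Omega>}" if "x \<in> ball x0 r" for x
    proof -
      have "x \<in> cball x0 (2 * r)" "cball y0 r \<subseteq> cball y0 (2 * r)" using that r by auto
      then show ?thesis using box K'(2) by blast
    qed
    define G where "G = (\<lambda>x. ennreal (K1 / \<beta>1) * (\<integral>\<^sup>+y. g (x, y) \<partial>lborel))"
    have Gm: "G \<in> borel_measurable borel"
    proof -
      have "(\<lambda>x. \<integral>\<^sup>+y. g (x, y) \<partial>lborel) \<in> borel_measurable lborel"
        by (rule sigma_finite_measure.borel_measurable_nn_integral_fst)
           (simp_all add: lborel.sigma_finite_measure_axioms lborel_prod)
      then show ?thesis unfolding G_def by simp
    qed
    have inner: "AE x in lebesgue. x \<in> ball x0 r \<longrightarrow> ennreal (\<phi> (v (x, y0))) \<le> G x"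
      using sh
    proof eventually_elim
      case (elim x)
      show ?case
      proof
        assume x: "x \<in> ball x0 r"
        let ?D = "{y. (x, y) \<in> \<Omega>}" and ?u = "\<lambda>y. u (x, y)"
        have uD: "usc_on ?D ?u" "sub_mean_value_on ?D ?u" "\<And>y. y \<in> ?D \<Longrightarrow> ?u y < \<infinity>"
          using elim unfolding subharmonic_on_def by auto
        have meas: "?u \<in> borel_measurable (lebesgue_on ?D)"
          using usc_on_measurable[OF slice_open(2)[OF \<Omega>] uD(1)] .
        obtain L where L: "0 \<le> L" "\<And>y. y \<in> cball y0 r \<Longrightarrow> ?u y \<le> ereal L"
          using usc_on_bounded_above[OF slice_open(2)[OF \<Omega>] uD(1) uD(3) compact_cball yin[OF x]] by auto
        have bd: "0 \<le> v (x, y) \<and> v (x, y) \<le> a * L" if y: "y \<in> ball y0 r" for y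
        proof -
          from y have "y \<in> cball y0 r" by auto
          then have "(x, y) \<in> \<Omega>" "u (x, y) \<le> ereal L" using L yin[OF x] by auto
          then have "shift_pos (- s) u (x, y) \<le> ennreal L"
            using L a(2) by (subst shift_pos_le_iff) (auto intro: order_trans)
          then have "enn2real (shift_pos (- s) u (x, y)) \<le> L" using L by (simp add: enn2real_leI)
          then show "0 \<le> v (x, y) \<and> v (x, y) \<le> a * L" using v0 a by (simp add: v_def)
        qed
        have "submean_on ?D (shift_pos (- s) ?u)"
          using submean_on_shift_pos[OF uD(2) meas] .
        then have "submean_on ?D (\<lambda>y. ennreal a * shift_pos (- s) ?u y)"
          using meas by (intro submean_on_cmult) measurable
        then have "submean_on ?D (\<lambda>y. ennreal (v (x, y)))"
          by (rule submean_on_cong) (simp add: v_enn shift_pos_def)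
        then have sm: "submean_on (ball y0 r) (\<lambda>y. ennreal (v (x, y)))"
          by (rule submean_on_subset) (use yin[OF x] ball_subset_cball[of y0 r] in blast)
        have gm: "(\<lambda>y. g (x, y)) \<in> borel_measurable borel"
          by (rule measurable_compose[OF _ g]) (intro borel_measurable_continuous_onI continuous_intros)
        have gd: "ennreal (\<phi> (v (x, y))) \<le> g (x, y)" if "y \<in> ball y0 r" for y
          using x that box r by (intro vg subsetD[OF box]) auto
        have "ennreal (\<phi> (v (x, y0))) * ennreal \<beta>1 \<le> ennreal K1 * (\<integral>\<^sup>+y\<in>ball y0 r. g (x, y) \<partial>lebesgue)"
          using K1(2)[OF r bd sm, of "\<lambda>y. g (x, y)"] gm gd \<beta>1(2) by (simp add: measurable_completion)
        also have "\<dots> \<le> ennreal K1 * (\<integral>\<^sup>+y. g (x, y) \<partial>lborel)"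
          unfolding nn_integral_completion
          by (intro mult_left_mono nn_integral_mono) (auto split: split_indicator)
        finally show "ennreal (\<phi> (v (x, y0))) \<le> G x"
          unfolding G_def using K1(1) \<beta>1(1) \<phi>nn[OF v0] by (intro ennreal_mult_le_divide) auto
      qed
    qed
    let ?D = "{x. (x, y0) \<in> \<Omega>}" and ?u = "\<lambda>x. u (x, y0)"
    have uD: "sub_mean_value_on ?D ?u" "?u \<in> borel_measurable (lebesgue_on ?D)"
      using ns[of y0] unfolding nearly_subharmonic_on_def by auto
    obtain L where L: "0 \<le> L" "\<And>x. x \<in> ball x0 r \<Longrightarrow> pos_part ?u x \<le> L"
      using nearly_subharmonic_bounded[OF ns r xin] by auto
    have bd: "0 \<le> v (x, y0) \<and> v (x, y0) \<le> a * L" if x: "x \<in> ball x0 r" for x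
    proof -
      from x r have "x \<in> cball x0 (2 * r)" by auto
      then have "(x, y0) \<in> \<Omega>" using xin by auto
      moreover have "pos_part u (x, y0) \<le> L" using L(2)[OF x] by (simp add: pos_part_def)
      ultimately show "0 \<le> v (x, y0) \<and> v (x, y0) \<le> a * L"
        using v0 a L(1) by (simp add: v_eq)
    qed
    have "submean_on ?D (shift_pos (- s) ?u)"
      using submean_on_shift_pos[OF uD] .
    then have "submean_on ?D (\<lambda>x. ennreal a * shift_pos (- s) ?u x)"
      using uD(2) by (intro submean_on_cmult) measurable
    then have "submean_on ?D (\<lambda>x. ennreal (v (x, y0)))"
      by (rule submean_on_cong) (simp add: v_enn shift_pos_def)
    then have sm: "submean_on (ball x0 r) (\<lambda>x. ennreal (v (x, y0)))"
    proof (rule submean_on_subset)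
      have "ball x0 r \<subseteq> cball x0 (2 * r)" using r by auto
      then show "ball x0 r \<subseteq> ?D" using xin by blast
    qed
    have "ennreal (\<phi> (v (x0, y0))) * ennreal \<beta>2 \<le> ennreal K2 * (\<integral>\<^sup>+x\<in>ball x0 r. G x \<partial>lebesgue)"
      using K2(2)[OF r bd sm _ inner] Gm \<beta>2(2) by (simp add: measurable_completion)
    also have "(\<integral>\<^sup>+x\<in>ball x0 r. G x \<partial>lebesgue) \<le> (\<integral>\<^sup>+x. G x \<partial>lborel)"
      unfolding nn_integral_completion
      by (intro nn_integral_mono) (auto split: split_indicator)
    also have "(\<integral>\<^sup>+x. G x \<partial>lborel) = ennreal (K1 / \<beta>1) * (\<integral>\<^sup>+x. \<integral>\<^sup>+y. g (x, y) \<partial>lborel \<partial>lborel)"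
      unfolding G_def
      by (intro nn_integral_cmult sigma_finite_measure.borel_measurable_nn_integral_fst)
         (simp_all add: lborel.sigma_finite_measure_axioms lborel_prod)
    also have "(\<integral>\<^sup>+x. \<integral>\<^sup>+y. g (x, y) \<partial>lborel \<partial>lborel) = ennreal J"
      unfolding J(1)[symmetric] lborel_prod[symmetric]
      by (intro lborel.nn_integral_fst) (simp add: lborel_prod)
    finally have "ennreal (\<phi> (v (x0, y0))) * ennreal \<beta>2 \<le> ennreal K2 * (ennreal (K1 / \<beta>1) * ennreal J)"
      by (simp add: mult_left_mono)
    then have "ennreal (\<phi> (v (x0, y0))) \<le> ennreal (K2 / \<beta>2) * (ennreal (K1 / \<beta>1) * ennreal J)"
      using K2(1) \<beta>2(1) \<phi>nn[OF v0] by (intro ennreal_mult_le_divide) auto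
    also have "\<dots> = ennreal B"
      unfolding B_def using K1(1) K2(1) \<beta>1(1) \<beta>2(1) J(2) by (simp add: ennreal_mult[symmetric])
    finally show ?thesis
      using K1(1) K2(1) \<beta>1(1) \<beta>2(1) J(2) by (simp add: B_def ennreal_le_iff)
  qed
  have "0 \<le> B" unfolding B_def using K1(1) K2(1) \<beta>1(1) \<beta>2(1) J(2) by simp
  then obtain q where q: "0 \<le> q" "\<phi> q = B" using \<phi>(2) by (metis atLeast_iff imageE)
  show ?thesis
  proof (rule that[of "q / a + s"])
    fix z assume z: "z \<in> K"
    then have zO: "z \<in> \<Omega>" using K by auto
    have "\<phi> (v z) \<le> \<phi> q" using bound[of "fst z" "snd z"] z q by simp
    then have "v z \<le> q" using strict_mono_onD[OF \<phi>(1), of q "v z"] q v0[of z] by force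
    then have "enn2real (shift_pos (- s) u z) \<le> q / a" using a by (simp add: v_def field_simps)
    moreover have "shift_pos (- s) u z < top" using shift_pos_less_top[of u z "- s"] fin[OF zO] .
    ultimately have "shift_pos (- s) u z \<le> ennreal (q / a)"
      using q a by (cases "shift_pos (- s) u z") (auto intro: ennreal_leI)
    then show "u z \<le> ereal (q / a + s)" using shift_pos_le_iff[of "q / a" "- s" u z] q a by simp
  qed
qed

section \<open>Joint upper semicontinuity\<close>

text \<open>
  The unnormalised mean of \<open>w\<close> in the first variable. Closed balls are used because their indicators
  are upper semicontinuous.
\<close>

definition ball_int :: "real \<Rightarrow> ('a::euclidean_space \<times> 'b::euclidean_space \<Rightarrow> ennreal) \<Rightarrow> 'a \<times> 'b \<Rightarrow> ennreal" where
  "ball_int r w = (\<lambda>(x, y). \<integral>\<^sup>+x'\<in>cball x r. w (x', y) \<partial>lebesgue)"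

lemma emeasure_lebesgue_cball:
  fixes x :: "'a::euclidean_space"
  assumes "0 < r"
  shows "emeasure lebesgue (cball x r) = emeasure lborel (ball x r)"
  using assms by (simp add: emeasure_cball emeasure_ball)

text \<open>
  Averaging in \<open>x\<close> turns upper semicontinuity in \<open>y\<close> into joint upper semicontinuity, by the reverse
  Fatou lemma: for fixed \<open>x'\<close>, both \<open>w (x', y)\<close> and the indicator of \<open>x' \<in> cball x r\<close> are upper
  semicontinuous in \<open>(x, y)\<close>.
\<close>
lemma open_ball_int_less:
  fixes w :: "'a::euclidean_space \<times> 'b::euclidean_space \<Rightarrow> ennreal"
  assumes usc: "\<And>x a. open {y. w (x, y) < a}"
    and meas: "\<And>y. (\<lambda>x. w (x, y)) \<in> borel_measurable lebesgue"
    and bd: "\<And>z. w z \<le> ennreal L * indicator (cball x0 R \<times> UNIV) z"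
  shows "open {z. ball_int r w z < c}"
proof -
  have "closed {z. c \<le> ball_int r w z}"
    unfolding closed_sequential_limits
  proof (intro allI impI, elim conjE)
    fix Z :: "nat \<Rightarrow> 'a \<times> 'b" and l assume Z: "\<forall>n. Z n \<in> {z. c \<le> ball_int r w z}" "Z \<longlonglongrightarrow> l"
    obtain x y where l: "l = (x, y)" by (cases l)
    define X Y where "X = (\<lambda>n. fst (Z n))" and "Y = (\<lambda>n. snd (Z n))"
    have XY: "X \<longlonglongrightarrow> x" "Y \<longlonglongrightarrow> y"
      using tendsto_fst[OF Z(2)] tendsto_snd[OF Z(2)] by (simp_all add: X_def Y_def l)
    define h where "h = (\<lambda>n x'. w (x', Y n) * indicator (cball (X n) r) x')"
    have hm: "h n \<in> borel_measurable lebesgue" for n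
      unfolding h_def by (intro borel_measurable_times_ennreal meas borel_measurable_indicator) auto
    have hint: "ball_int r w (Z n) = integral\<^sup>N lebesgue (h n)" for n
      by (simp add: ball_int_def h_def X_def Y_def split_beta)
    let ?b = "\<lambda>x'. ennreal L * indicator (cball x0 R) x'"
    have hb: "h n x' \<le> ?b x'" for n x'
    proof -
      have "h n x' \<le> w (x', Y n)" by (auto simp: h_def split: split_indicator)
      also have "\<dots> \<le> ?b x'" using bd[of "(x', Y n)"] by (auto split: split_indicator)
      finally show ?thesis .
    qed
    have bint: "(\<integral>\<^sup>+x'. ?b x' \<partial>lebesgue) < \<infinity>"
      using emeasure_lborel_cball_finite[of x0 R]
      by (subst nn_integral_cmult_indicator) (auto simp: ennreal_mult_less_top)
    have "c \<le> limsup (\<lambda>n. integral\<^sup>N lebesgue (h n))"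
      using Z(1) hint by (intro order_trans[OF _ Liminf_le_Limsup] Liminf_bounded) auto
    also have "\<dots> \<le> (\<integral>\<^sup>+x'. limsup (\<lambda>n. h n x') \<partial>lebesgue)"
      using hm hb bint
      by (intro nn_integral_limsup[where w = ?b] borel_measurable_times_ennreal borel_measurable_indicator) auto
    also have "\<dots> \<le> (\<integral>\<^sup>+x'. w (x', y) * indicator (cball x r) x' \<partial>lebesgue)"
    proof (rule nn_integral_mono, subst Limsup_le_iff, intro allI impI)
      fix x' d assume d: "w (x', y) * indicator (cball x r) x' < d"
      show "\<forall>\<^sub>F n in sequentially. h n x' < d"
      proof (cases "x' \<in> cball x r")
        case True
        then have "y \<in> {y. w (x', y) < d}" using d by simp
        then have "\<forall>\<^sub>F n in sequentially. Y n \<in> {y. w (x', y) < d}"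
          using topological_tendstoD[OF XY(2) usc] by blast
        then show ?thesis
          by eventually_elim (auto simp: h_def split: split_indicator intro: le_less_trans[of 0])
      next
        case False
        then have "r < dist x x'" by simp
        then have "\<forall>\<^sub>F n in sequentially. r < dist (X n) x'"
          using order_tendstoD(1)[OF tendsto_dist[OF XY(1) tendsto_const]] by blast
        then show ?thesis
          by (rule eventually_mono) (use d False in \<open>auto simp: h_def\<close>)
      qed
    qed
    also have "\<dots> = ball_int r w l" by (simp add: ball_int_def l)
    finally show "l \<in> {z. c \<le> ball_int r w z}" by simp
  qed
  then have "open (- {z. c \<le> ball_int r w z})" by (rule open_Compl)
  moreover have "- {z. c \<le> ball_int r w z} = {z. ball_int r w z < c}" by (auto simp: not_le)
  ultimately show ?thesis by simp
qed

lemma borel_measurable_open_less: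
  fixes f :: "'a::topological_space \<Rightarrow> ennreal"
  assumes "\<And>a. open {z. f z < a}" shows "f \<in> borel_measurable borel"
  using assms by (intro borel_measurableI_less) auto

text \<open>
  The properties of \<open>f = (u + M)\<^sup>+\<close>. Note the asymmetry: the sub-mean value property holds on
  all slices in \<open>x\<close>, but upper semicontinuity on almost all of them only; on slices in \<open>y\<close> it is the
  other way round.
\<close>
locale separately_submean =
  fixes \<Omega> :: "('a::euclidean_space \<times> 'b::euclidean_space) set" and f :: "'a \<times> 'b \<Rightarrow> ennreal"
  assumes open_dom: "open \<Omega>"
    and meas_x: "\<And>y. (\<lambda>x. f (x, y)) \<in> borel_measurable (lebesgue_on {x. (x, y) \<in> \<Omega>})"
    and submean_x: "\<And>y. submean_on {x. (x, y) \<in> \<Omega>} (\<lambda>x. f (x, y))"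
    and usc_x: "AE y in lborel. \<forall>a. open {x. (x, y) \<in> \<Omega> \<and> f (x, y) < a}"
    and usc_y: "\<And>x a. open {y. (x, y) \<in> \<Omega> \<and> f (x, y) < a}"
    and submean_y: "AE x in lborel. submean_on {y. (x, y) \<in> \<Omega>} (\<lambda>y. f (x, y))"
    and bounded: "\<And>K. compact K \<Longrightarrow> K \<subseteq> \<Omega> \<Longrightarrow> \<exists>L::real. \<forall>z\<in>K. f z \<le> ennreal L"
begin

text \<open>
  The restriction of \<open>f\<close> to a closed box, extended by zero. As \<open>f\<close> is nonnegative and the box
  closed, this preserves upper semicontinuity of the slices.
\<close>

definition cut :: "'a \<Rightarrow> real \<Rightarrow> 'b \<Rightarrow> real \<Rightarrow> 'a \<times> 'b \<Rightarrow> ennreal" where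
  "cut x0 R y0 S z = f z * indicator (cball x0 R \<times> cball y0 S) z"

context
  fixes x0 :: 'a and y0 :: 'b and R S :: real
  assumes R: "0 < R" and S: "0 < S" and box: "cball x0 R \<times> cball y0 S \<subseteq> \<Omega>"
begin

abbreviation "w \<equiv> cut x0 R y0 S"

lemma cut_usc: "open {y. w (x, y) < a}"
proof (cases "a = 0 \<or> x \<notin> cball x0 R")
  case True
  then have "{y. w (x, y) < a} = {} \<or> {y. w (x, y) < a} = UNIV"
    by (cases "a = 0") (auto simp: cut_def zero_less_iff_neq_zero)
  then show ?thesis by auto
next
  case False
  have "{y. w (x, y) < a} = - cball y0 S \<union> {y. (x, y) \<in> \<Omega> \<and> f (x, y) < a}"
    using False box by (auto simp: cut_def zero_less_iff_neq_zero split: split_indicator)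
  then show ?thesis using usc_y by (auto intro!: open_Un)
qed

lemma cut_meas: "(\<lambda>x. w (x, y)) \<in> borel_measurable lebesgue"
proof (cases "y \<in> cball y0 S")
  case True
  have "(\<lambda>x. f (x, y)) \<in> borel_measurable (lebesgue_on (cball x0 R))"
    using box True by (intro measurable_restrict_mono[OF meas_x]) auto
  then have "(\<lambda>x. f (x, y) * indicator (cball x0 R) x) \<in> borel_measurable lebesgue"
    by (subst (asm) borel_measurable_restrict_space_iff_ennreal) auto
  moreover have "(\<lambda>x. w (x, y)) = (\<lambda>x. f (x, y) * indicator (cball x0 R) x)"
    using True by (auto simp: cut_def fun_eq_iff split: split_indicator)
  ultimately show ?thesis by simp
next
  case False then show ?thesis by (simp add: cut_def)
qed

lemma cut_bounded: "\<exists>L\<ge>0. \<forall>z. w z \<le> ennreal L * indicator (cball x0 R \<times> UNIV) z"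
proof -
  obtain L where L: "\<And>z. z \<in> cball x0 R \<times> cball y0 S \<Longrightarrow> f z \<le> ennreal L"
    using bounded[OF compact_Times[OF compact_cball compact_cball] box] by blast
  have "f z \<le> ennreal (max L 0)" if "z \<in> cball x0 R \<times> cball y0 S" for z
    using L[OF that] by (rule order_trans) (auto intro: ennreal_leI)
  then show ?thesis
    by (intro exI[of _ "max L 0"]) (auto simp: cut_def split: split_indicator)
qed

lemma open_ball_int_cut: "open {z. ball_int r w z < c}"
  using cut_bounded open_ball_int_less[OF cut_usc cut_meas] by blast

lemma le_ball_int_cut:
  assumes r: "0 < r" and "cball x r \<subseteq> cball x0 R" "y \<in> cball y0 S"
  shows "f (x, y) * emeasure lborel (ball x r) \<le> ball_int r w (x, y)"
proof -
  have sub: "cball x r \<subseteq> {x. (x, y) \<in> \<Omega>}" using assms box by blast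
  have "f (x, y) * emeasure lborel (ball x r) \<le> (\<integral>\<^sup>+x'\<in>ball x r. f (x', y) \<partial>lebesgue)"
    using submean_x[of y] r sub unfolding submean_on_def by blast
  also have "\<dots> \<le> (\<integral>\<^sup>+x'\<in>cball x r. w (x', y) \<partial>lebesgue)"
  proof (rule nn_integral_mono)
    fix x'
    have "x' \<in> cball x r \<Longrightarrow> x' \<in> cball x0 R" using assms(2) by blast
    then show "f (x', y) * indicator (ball x r) x' \<le> w (x', y) * indicator (cball x r) x'"
      using assms(3) by (auto simp: cut_def split: split_indicator)
  qed
  finally show ?thesis by (simp add: ball_int_def)
qed

text \<open>
  The central estimate: at every point \<open>(x0, y0)\<close>, means of \<open>f\<close> in \<open>x\<close> over small balls are
  asymptotically at most the mean of \<open>f (x0, \<cdot>)\<close> over \<open>cball y0 S\<close>. Let \<open>A k\<close> be the unnormalised means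
  in \<open>x\<close> of radius \<open>\<rho> k \<rightarrow> 0\<close>. Use the sub-mean value property in \<open>y\<close> (almost every \<open>x\<close>), then that
  in \<open>x\<close> to replace \<open>f\<close> by the normalised \<open>A k\<close>.
  Joint measurability of \<open>f\<close> is not known at this point, but \<open>A k\<close> is jointly Borel, so that Tonelli's
  theorem allows exchanging the integrals. What remains are double means in \<open>x\<close> around \<open>x0\<close> on slices \<open>y\<close>; for almost
  every \<open>y\<close> their upper limit is at most \<open>f (x0, y)\<close> by upper semicontinuity in \<open>x\<close>, and the reverse
  Fatou lemma concludes.
\<close>
lemma ball_int_less_slice_mean:
  assumes less: "(\<integral>\<^sup>+y\<in>cball y0 S. f (x0, y) \<partial>lborel) < c * emeasure lborel (ball y0 S)" and c: "c < top"
  shows "\<exists>r>0. 2 * r \<le> R \<and> ball_int r w (x0, y0) < c * emeasure lborel (ball x0 r)"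
proof -
  define \<rho> where "\<rho> = (\<lambda>k. R / 2 * inverse (real (Suc k)))"
  have \<rho>: "0 < \<rho> k" "2 * \<rho> k \<le> R" for k using R by (auto simp: \<rho>_def field_simps)
  have \<rho>0: "\<rho> \<longlonglongrightarrow> 0" unfolding \<rho>_def
    by (rule tendsto_mult_right_zero[OF LIMSEQ_inverse_real_of_nat])
  define \<alpha> where "\<alpha> = (\<lambda>k. measure lebesgue (ball (0::'a) 1) * \<rho> k ^ DIM('a))"
  have \<alpha>: "0 < \<alpha> k" "emeasure lborel (ball x (\<rho> k)) = ennreal (\<alpha> k)" for k and x :: 'a
    using emeasure_ball_unit[OF \<rho>(1)] by (auto simp: \<alpha>_def)
  have \<alpha>c: "emeasure lebesgue (cball x (\<rho> k)) = ennreal (\<alpha> k)" for k and x :: 'a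
    by (rule trans[OF emeasure_lebesgue_cball[OF \<rho>(1)] \<alpha>(2)])
  define b where "b = measure lebesgue (ball (0::'b) 1) * S ^ DIM('b)"
  have b: "0 < b" "emeasure lborel (ball y0 S) = ennreal b"
    using emeasure_ball_unit[OF S] by (auto simp: b_def)
  define A where "A = (\<lambda>k. ball_int (\<rho> k) w)"
  have A_m[measurable]: "A k \<in> borel_measurable borel" for k
    unfolding A_def by (rule borel_measurable_open_less) (rule open_ball_int_cut)
  obtain L where L: "0 \<le> L" "\<And>z. w z \<le> ennreal L * indicator (cball x0 R \<times> UNIV) z"
    using cut_bounded by blast
  have wL: "w z \<le> ennreal L" for z using L(2)[of z] by (auto split: split_indicator_asm)
  have near: "cball x (\<rho> k) \<subseteq> cball x0 R" if "x \<in> cball x0 (\<rho> k)" for x k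
  proof
    fix z assume "z \<in> cball x (\<rho> k)"
    then show "z \<in> cball x0 R" using that dist_triangle[of x0 z x] \<rho>(2)[of k] by auto
  qed
  have A_le: "A k (x, y) \<le> d * ennreal (\<alpha> k)" if "\<And>x'. x' \<in> cball x (\<rho> k) \<Longrightarrow> w (x', y) \<le> d" for k x y d
  proof -
    have "A k (x, y) \<le> (\<integral>\<^sup>+x'. d * indicator (cball x (\<rho> k)) x' \<partial>lebesgue)"
      unfolding A_def ball_int_def using that by (auto intro!: nn_integral_mono split: split_indicator)
    also have "\<dots> = d * ennreal (\<alpha> k)" by (subst nn_integral_cmult_indicator) (auto simp: \<alpha>c)
    finally show ?thesis .
  qed
  \<comment> \<open>\<open>F k\<close> restricts \<open>A k\<close> to the box of integration; \<open>T k y\<close> is its integral over the slice.\<close>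
  define F where "F = (\<lambda>k x y. A k (x, y) * (indicator (cball x0 (\<rho> k)) x * indicator (cball y0 S) y))"
  have F_m: "(\<lambda>(x, y). F k x y) \<in> borel_measurable (lborel \<Otimes>\<^sub>M lborel)" for k
  proof -
    have "(\<lambda>(x, y). F k x y) = (\<lambda>z. A k z * indicator (cball x0 (\<rho> k) \<times> cball y0 S) z)"
      by (auto simp: F_def fun_eq_iff split: split_indicator)
    moreover have "\<dots> \<in> borel_measurable borel"
      by (intro borel_measurable_times_ennreal A_m borel_measurable_indicator borel_closed closed_Times) auto
    ultimately show ?thesis by (simp add: lborel_prod)
  qed
  define T where "T = (\<lambda>k y. \<integral>\<^sup>+x. F k x y \<partial>lborel)"
  have T_m[measurable]: "T k \<in> borel_measurable lborel" for k
  proof -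
    have "(\<lambda>(y, x). F k x y) \<in> borel_measurable (lborel \<Otimes>\<^sub>M lborel)"
      using measurable_pair_swap[OF F_m[of k]] by (simp add: split_beta)
    then show ?thesis unfolding T_def
      by (rule lborel.borel_measurable_nn_integral[of "\<lambda>y x. F k x y"])
  qed
  have T_le: "T k y \<le> d * ennreal (\<alpha> k) * ennreal (\<alpha> k) * indicator (cball y0 S) y"
    if "\<And>x x'. x \<in> cball x0 (\<rho> k) \<Longrightarrow> x' \<in> cball x (\<rho> k) \<Longrightarrow> w (x', y) \<le> d" for k y d
  proof -
    have "T k y \<le> (\<integral>\<^sup>+x. (d * ennreal (\<alpha> k) * indicator (cball y0 S) y) * indicator (cball x0 (\<rho> k)) x \<partial>lborel)"
      unfolding T_def F_def using A_le[OF that] by (auto intro!: nn_integral_mono split: split_indicator)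
    also have "\<dots> = d * ennreal (\<alpha> k) * indicator (cball y0 S) y * emeasure lborel (cball x0 (\<rho> k))"
      by (rule nn_integral_cmult_indicator) simp
    also have "emeasure lborel (cball x0 (\<rho> k)) = ennreal (\<alpha> k)"
      using \<alpha>c[of x0 k] by simp
    finally show ?thesis by (simp add: mult_ac)
  qed
  \<comment> \<open>\<open>h k\<close> normalises both averages in \<open>x\<close>, so \<open>T k y * h k\<close> is a mean of values of \<open>w\<close>.\<close>
  define h where "h = (\<lambda>k. ennreal (1 / (\<alpha> k * \<alpha> k)))"
  have h: "ennreal (\<alpha> k) * ennreal (\<alpha> k) * h k = 1" for k
    using \<alpha>(1)[of k] by (simp add: h_def ennreal_mult[symmetric])
  have TH_le: "T k y * h k \<le> d * indicator (cball y0 S) y"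
    if "\<And>x x'. x \<in> cball x0 (\<rho> k) \<Longrightarrow> x' \<in> cball x (\<rho> k) \<Longrightarrow> w (x', y) \<le> d" for k y d
  proof -
    have "T k y * h k \<le> (d * ennreal (\<alpha> k) * ennreal (\<alpha> k) * indicator (cball y0 S) y) * h k"
      using T_le[OF that] by (rule mult_right_mono) auto
    also have "\<dots> = d * indicator (cball y0 S) y * (ennreal (\<alpha> k) * ennreal (\<alpha> k) * h k)"
      by (simp only: mult_ac)
    finally show ?thesis by (simp add: h)
  qed

  have main: "A k (x0, y0) * ennreal b * ennreal (\<alpha> k) \<le> (\<integral>\<^sup>+y. T k y \<partial>lborel)" for k
  proof -
    have "A k (x0, y0) * ennreal b * ennreal (\<alpha> k)
        = (\<integral>\<^sup>+x. w (x, y0) * indicator (cball x0 (\<rho> k)) x * (ennreal b * ennreal (\<alpha> k)) \<partial>lebesgue)"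
      unfolding A_def ball_int_def
      by (subst nn_integral_multc)
         (auto simp: mult.assoc intro!: borel_measurable_times_ennreal cut_meas borel_measurable_indicator)
    also have "\<dots> = (\<integral>\<^sup>+x. w (x, y0) * indicator (cball x0 (\<rho> k)) x * (ennreal b * ennreal (\<alpha> k)) \<partial>lborel)"
      by (rule nn_integral_completion)
    also have "\<dots> \<le> (\<integral>\<^sup>+x. \<integral>\<^sup>+y. F k x y \<partial>lborel \<partial>lborel)"
    proof (rule nn_integral_mono_AE, use submean_y in eventually_elim)
      case (elim x)
      show ?case
      proof (cases "x \<in> cball x0 (\<rho> k)")
        case True
        then have xR: "x \<in> cball x0 R" "x0 \<in> cball x0 R" using R \<rho>(1)[of k] \<rho>(2)[of k] by auto
        have sub: "cball y0 S \<subseteq> {y. (x, y) \<in> \<Omega>}" using xR box by blast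
        have wm: "(\<lambda>y. w (x, y)) \<in> borel_measurable lborel"
          using borel_measurable_open_less[OF cut_usc] by simp
        have "w (x, y0) * ennreal b \<le> f (x, y0) * ennreal b"
          by (intro mult_right_mono) (auto simp: cut_def split: split_indicator)
        also have "\<dots> \<le> (\<integral>\<^sup>+y\<in>ball y0 S. f (x, y) \<partial>lborel)"
          using elim S sub b(2) unfolding submean_on_def nn_integral_completion by metis
        also have "\<dots> \<le> (\<integral>\<^sup>+y. w (x, y) \<partial>lborel)"
          using xR by (intro nn_integral_mono) (auto simp: cut_def split: split_indicator)
        finally have "w (x, y0) * ennreal b * ennreal (\<alpha> k) \<le> (\<integral>\<^sup>+y. w (x, y) \<partial>lborel) * ennreal (\<alpha> k)"
          by (rule mult_right_mono) simp
        also have "\<dots> = (\<integral>\<^sup>+y. w (x, y) * ennreal (\<alpha> k) \<partial>lborel)"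
          using wm by (rule nn_integral_multc[symmetric])
        also have "\<dots> \<le> (\<integral>\<^sup>+y. F k x y \<partial>lborel)"
        proof (rule nn_integral_mono)
          fix y
          show "w (x, y) * ennreal (\<alpha> k) \<le> F k x y"
          proof (cases "y \<in> cball y0 S")
            case yS: True
            have "w (x, y) * ennreal (\<alpha> k) \<le> f (x, y) * emeasure lborel (ball x (\<rho> k))"
              by (auto simp: cut_def \<alpha>(2) split: split_indicator)
            also have "\<dots> \<le> A k (x, y)"
              unfolding A_def by (rule le_ball_int_cut[OF \<rho>(1) near[OF True] yS])
            finally show ?thesis using True yS by (simp add: F_def)
          next
            case False then show ?thesis by (simp add: cut_def)
          qed
        qed
        finally show ?thesis using True by (simp add: mult.assoc)
      qed simp
    qed
    also have "\<dots> = (\<integral>\<^sup>+y. T k y \<partial>lborel)"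
      unfolding T_def using lborel_pair.Fubini'[OF F_m[of k]] by simp
    finally show ?thesis .
  qed

  have "limsup (\<lambda>k. \<integral>\<^sup>+y. T k y * h k \<partial>lborel) \<le> (\<integral>\<^sup>+y. limsup (\<lambda>k. T k y * h k) \<partial>lborel)"
  proof (rule nn_integral_limsup)
    show "AE y in lborel. T k y * h k \<le> ennreal L * indicator (cball y0 S) y" for k
      using TH_le[of k _ "ennreal L"] wL by (intro AE_I2) auto
    have "(\<integral>\<^sup>+y. ennreal L * indicator (cball y0 S) y \<partial>lborel) = ennreal L * emeasure lborel (cball y0 S)"
      by (rule nn_integral_cmult_indicator) simp
    then show "(\<integral>\<^sup>+y. ennreal L * indicator (cball y0 S) y \<partial>lborel) < \<infinity>"
      using emeasure_lborel_cball_finite[of y0 S] by (simp add: ennreal_mult_less_top)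
  qed (auto intro!: borel_measurable_times_ennreal borel_measurable_indicator)
  also have "\<dots> \<le> (\<integral>\<^sup>+y\<in>cball y0 S. f (x0, y) \<partial>lborel)"
  proof (rule nn_integral_mono_AE, use usc_x in eventually_elim)
    case (elim y)
    show "limsup (\<lambda>k. T k y * h k) \<le> f (x0, y) * indicator (cball y0 S) y"
    proof (subst Limsup_le_iff, intro allI impI)
      fix d assume d: "f (x0, y) * indicator (cball y0 S) y < d"
      show "\<forall>\<^sub>F k in sequentially. T k y * h k < d"
      proof (cases "y \<in> cball y0 S")
        case False
        have "T k y * h k < d" for k
        proof -
          have "T k y * h k \<le> ennreal L * indicator (cball y0 S) y"
            by (rule TH_le) (rule wL)
          also have "\<dots> = f (x0, y) * indicator (cball y0 S) y" using False by simp
          finally show ?thesis using d by (rule le_less_trans)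
        qed
        then show ?thesis by (intro always_eventually allI)
      next
        case True
        with d have "f (x0, y) < d" by simp
        then obtain d' where d': "f (x0, y) < d'" "d' < d" using dense by blast
        have "x0 \<in> {x. (x, y) \<in> \<Omega> \<and> f (x, y) < d'}" using box True R d' by auto
        moreover have "open {x. (x, y) \<in> \<Omega> \<and> f (x, y) < d'}" using elim by blast
        ultimately obtain \<delta> where \<delta>: "0 < \<delta>" "ball x0 \<delta> \<subseteq> {x. (x, y) \<in> \<Omega> \<and> f (x, y) < d'}"
          by (meson openE)
        have "\<forall>\<^sub>F k in sequentially. \<rho> k < \<delta> / 2"
          by (rule order_tendstoD(2)[OF \<rho>0]) (use \<delta> in simp)
        then show ?thesis
        proof eventually_elim
          case (elim k)
          have "T k y * h k \<le> d' * indicator (cball y0 S) y"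
          proof (rule TH_le)
            fix x x' assume "x \<in> cball x0 (\<rho> k)" "x' \<in> cball x (\<rho> k)"
            then have "x' \<in> ball x0 \<delta>" using dist_triangle[of x0 x' x] elim by auto
            then have "f (x', y) < d'" using \<delta> by auto
            then show "w (x', y) \<le> d'" by (auto simp: cut_def split: split_indicator)
          qed
          then show ?case using True d' by (auto intro: le_less_trans)
        qed
      qed
    qed
  qed
  also note less
  finally have "limsup (\<lambda>k. \<integral>\<^sup>+y. T k y * h k \<partial>lborel) < c * ennreal b" by (simp add: b(2))
  then have "\<forall>\<^sub>F k in sequentially. (\<integral>\<^sup>+y. T k y * h k \<partial>lborel) < c * ennreal b"
    by (rule Limsup_lessD)
  then obtain k where k: "(\<integral>\<^sup>+y. T k y * h k \<partial>lborel) < c * ennreal b"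
    using eventually_happens'[OF sequentially_bot] by blast
  have "A k (x0, y0) < c * ennreal (\<alpha> k)"
  proof (rule ccontr)
    assume "\<not> ?thesis"
    then have "c * ennreal (\<alpha> k) \<le> A k (x0, y0)" by simp
    then have "c * ennreal (\<alpha> k) * (ennreal b * ennreal (\<alpha> k) * h k)
        \<le> A k (x0, y0) * (ennreal b * ennreal (\<alpha> k) * h k)"
      by (rule mult_right_mono) simp
    also have "\<dots> = (A k (x0, y0) * ennreal b * ennreal (\<alpha> k)) * h k" by (simp only: mult_ac)
    also have "\<dots> \<le> (\<integral>\<^sup>+y. T k y \<partial>lborel) * h k" using main by (rule mult_right_mono) simp
    also have "\<dots> = (\<integral>\<^sup>+y. T k y * h k \<partial>lborel)" by (rule nn_integral_multc[symmetric]) simp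
    also have "\<dots> < c * ennreal b" by (rule k)
    also have "c * ennreal b = c * ennreal b * (ennreal (\<alpha> k) * ennreal (\<alpha> k) * h k)" by (simp add: h)
    also have "\<dots> = c * ennreal (\<alpha> k) * (ennreal b * ennreal (\<alpha> k) * h k)" by (simp only: mult_ac)
    finally show False by simp
  qed
  then show ?thesis using \<rho> by (intro exI[of _ "\<rho> k"]) (auto simp: A_def \<alpha>(2))
qed

end

lemma box_nbhd:
  assumes "cball y0 S \<subseteq> {y. (x0, y) \<in> \<Omega>}"
  obtains R where "0 < R" "cball x0 R \<times> cball y0 S \<subseteq> \<Omega>"
proof -
  have "compact ({x0} \<times> cball y0 S)" "{x0} \<times> cball y0 S \<subseteq> \<Omega>"
    using assms by (auto intro: compact_Times)
  then obtain e where e: "0 < e" "(\<Union>z\<in>{x0} \<times> cball y0 S. cball z e) \<subseteq> \<Omega>"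
    using compact_subset_open_imp_cball_epsilon_subset[OF _ open_dom] by metis
  show ?thesis
  proof (rule that[OF e(1)], clarify)
    fix x y assume "x \<in> cball x0 e" "y \<in> cball y0 S"
    then have "(x, y) \<in> cball (x0, y) e" "(x0, y) \<in> {x0} \<times> cball y0 S" by (auto simp: dist_Pair_Pair)
    then show "(x, y) \<in> \<Omega>" using e(2) by blast
  qed
qed

text \<open>
  The sub-mean value property in \<open>y\<close> thus extends from almost every to every \<open>x0\<close>: if it failed,
  the central estimate with \<open>c = f (x0, y0)\<close> would contradict \<open>f (x0, y0) * |B| \<le> ball_int\<close>.
\<close>
lemma submean_y_all: "submean_on {y. (x0, y) \<in> \<Omega>} (\<lambda>y. f (x0, y))"
  unfolding submean_on_def
proof (intro allI impI, elim conjE)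
  fix y0 S assume S: "0 < S" and sub: "cball y0 S \<subseteq> {y. (x0, y) \<in> \<Omega>}"
  obtain R where R: "0 < R" and box: "cball x0 R \<times> cball y0 S \<subseteq> \<Omega>" using box_nbhd[OF sub] by metis
  have in_box: "(x0, y0) \<in> cball x0 R \<times> cball y0 S" using R S by simp
  have fin: "f (x0, y0) < top"
    using bounded[OF compact_Times[OF compact_cball compact_cball] box] in_box
    by (metis ennreal_less_top le_less_trans)
  show "f (x0, y0) * emeasure lborel (ball y0 S) \<le> (\<integral>\<^sup>+y\<in>ball y0 S. f (x0, y) \<partial>lebesgue)"
  proof (rule ccontr)
    assume "\<not> ?thesis"
    then have less: "(\<integral>\<^sup>+y\<in>ball y0 S. f (x0, y) \<partial>lborel) < f (x0, y0) * emeasure lborel (ball y0 S)"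
      by (simp add: nn_integral_completion)
    have "sphere y0 S \<in> null_sets lborel"
      using negligible_sphere[of y0 S] by (auto simp: null_sets_completion_iff negligible_iff_null_sets)
    then have "AE y in lborel. y \<notin> sphere y0 S" by (rule AE_not_in)
    then have "(\<integral>\<^sup>+y\<in>cball y0 S. f (x0, y) \<partial>lborel) = (\<integral>\<^sup>+y\<in>ball y0 S. f (x0, y) \<partial>lborel)"
      by (intro nn_integral_cong_AE) (auto elim!: eventually_mono split: split_indicator)
    then obtain r where r: "0 < r" "2 * r \<le> R"
      and "ball_int r (cut x0 R y0 S) (x0, y0) < f (x0, y0) * emeasure lborel (ball x0 r)"
      using ball_int_less_slice_mean[OF R S box _ fin] less by auto
    moreover have "f (x0, y0) * emeasure lborel (ball x0 r) \<le> ball_int r (cut x0 R y0 S) (x0, y0)"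
      using r R in_box by (intro le_ball_int_cut[OF R S box]) auto
    ultimately show False by simp
  qed
qed

text \<open>
  If \<open>f (x0, y0) < c\<close>, upper semicontinuity in \<open>y\<close> and the central estimate give a radius for
  which the mean in \<open>x\<close> at \<open>(x0, y0)\<close> is less than \<open>c\<close>. This persists nearby, since that mean is
  jointly upper semicontinuous, and it dominates \<open>f\<close>.
\<close>
lemma joint_usc: "open {z. z \<in> \<Omega> \<and> f z < c}"
proof (subst open_subopen, clarify)
  fix x0 y0 assume z0: "(x0, y0) \<in> \<Omega>" "f (x0, y0) < c"
  obtain c' where c': "f (x0, y0) < c'" "c' < c" using z0(2) dense by blast
  have "y0 \<in> {y. (x0, y) \<in> \<Omega> \<and> f (x0, y) < c'}" using z0 c' by simp
  then obtain S where S: "0 < S" "cball y0 S \<subseteq> {y. (x0, y) \<in> \<Omega> \<and> f (x0, y) < c'}"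
    using usc_y open_contains_cball by metis
  then have "cball y0 S \<subseteq> {y. (x0, y) \<in> \<Omega>}" by blast
  then obtain R where R: "0 < R" and box: "cball x0 R \<times> cball y0 S \<subseteq> \<Omega>" using box_nbhd by metis
  obtain c'' where c'': "c' < c''" "c'' < c" using c' dense by blast
  have fin: "c'' < top" using c'' by (auto intro: less_le_trans)
  have b: "0 < emeasure lborel (ball y0 S)" "emeasure lborel (ball y0 S) < top"
    using emeasure_ball_unit(1)[OF S(1), of y0] emeasure_ball_unit(2)[OF S(1), where 'a='b] by auto
  have "(\<integral>\<^sup>+y\<in>cball y0 S. f (x0, y) \<partial>lborel) \<le> (\<integral>\<^sup>+y. c' * indicator (cball y0 S) y \<partial>lborel)"
  proof (rule nn_integral_mono)
    fix y
    have "f (x0, y) \<le> c'" if "y \<in> cball y0 S" using S(2) that by auto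
    then show "f (x0, y) * indicator (cball y0 S) y \<le> c' * indicator (cball y0 S) y"
      by (auto split: split_indicator)
  qed
  also have "\<dots> = c' * emeasure lborel (ball y0 S)"
    using S(1) emeasure_lebesgue_cball[of S y0] by (subst nn_integral_cmult_indicator) auto
  also have "\<dots> < c'' * emeasure lborel (ball y0 S)"
    using c'' b by (intro ennreal_mult_strict_right_mono)
  finally obtain r where r: "0 < r" "2 * r \<le> R"
    and less: "ball_int r (cut x0 R y0 S) (x0, y0) < c'' * emeasure lborel (ball x0 r)"
    using ball_int_less_slice_mean[OF R S(1) box _ fin] by blast
  let ?U = "{z. ball_int r (cut x0 R y0 S) z < c'' * emeasure lborel (ball x0 r)} \<inter> (ball x0 r \<times> ball y0 S)"
  have "open ?U"
    using open_ball_int_cut[OF R S(1) box] by (intro open_Int open_Times) auto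
  moreover have "(x0, y0) \<in> ?U" using less r S by simp
  moreover have "?U \<subseteq> {z. z \<in> \<Omega> \<and> f z < c}"
  proof clarify
    fix x y assume x: "x \<in> ball x0 r" and y: "y \<in> ball y0 S"
      and l: "ball_int r (cut x0 R y0 S) (x, y) < c'' * emeasure lborel (ball x0 r)"
    have sub: "cball x r \<subseteq> cball x0 R"
    proof
      fix z assume "z \<in> cball x r"
      then show "z \<in> cball x0 R" using x dist_triangle[of x0 z x] r(2) by auto
    qed
    have yS: "y \<in> cball y0 S" using y by simp
    have "x \<in> cball x r" using r by simp
    then have "x \<in> cball x0 R" using sub by blast
    then have "(x, y) \<in> \<Omega>" using box yS by blast
    have "f (x, y) * emeasure lborel (ball x r) \<le> ball_int r (cut x0 R y0 S) (x, y)"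
      by (rule le_ball_int_cut[OF R S(1) box r(1) sub yS])
    also note l
    also have "emeasure lborel (ball x0 r) = emeasure lborel (ball x r)"
      using emeasure_ball_unit(1)[OF r(1), of x] emeasure_ball_unit(1)[OF r(1), of x0] by simp
    finally have "f (x, y) < c''"
      by (meson leD leI mult_right_mono zero_le)
    then show "(x, y) \<in> \<Omega> \<and> f (x, y) < c" using c'' \<open>(x, y) \<in> \<Omega>\<close> by auto
  qed
  ultimately show "\<exists>T. open T \<and> (x0, y0) \<in> T \<and> T \<subseteq> {z. z \<in> \<Omega> \<and> f z < c}" by blast
qed

end

section \<open>Means over balls in the product space\<close>

text \<open>
  The slices of a Euclidean ball in a product space are balls with the same centre, possibly empty.
\<close>
lemma ball_slice:
  fixes x0 :: "'a::euclidean_space" and y0 :: "'b::euclidean_space"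
  assumes "0 < \<rho>"
  obtains t where "{x. (x, y) \<in> ball (x0, y0) \<rho>} = ball x0 t"
proof (cases "dist y0 y < \<rho>")
  case True
  have "(x, y) \<in> ball (x0, y0) \<rho> \<longleftrightarrow> x \<in> ball x0 (sqrt (\<rho>\<^sup>2 - (dist y0 y)\<^sup>2))" for x
  proof -
    have "(x, y) \<in> ball (x0, y0) \<rho> \<longleftrightarrow> sqrt ((dist x0 x)\<^sup>2 + (dist y0 y)\<^sup>2) < sqrt (\<rho>\<^sup>2)"
      using assms by (simp add: dist_Pair_Pair)
    also have "\<dots> \<longleftrightarrow> (dist x0 x)\<^sup>2 < \<rho>\<^sup>2 - (dist y0 y)\<^sup>2"
      unfolding real_sqrt_less_iff by auto
    also have "\<dots> \<longleftrightarrow> sqrt ((dist x0 x)\<^sup>2) < sqrt (\<rho>\<^sup>2 - (dist y0 y)\<^sup>2)"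
      by (rule real_sqrt_less_iff[symmetric])
    finally show ?thesis by simp
  qed
  then have "{x. (x, y) \<in> ball (x0, y0) \<rho>} = ball x0 (sqrt (\<rho>\<^sup>2 - (dist y0 y)\<^sup>2))" by blast
  then show ?thesis by (rule that)
next
  case False
  have "(x, y) \<notin> ball (x0, y0) \<rho>" for x
    using False dist_snd_le[of "(x0, y0)" "(x, y)"] by auto
  then have "{x. (x, y) \<in> ball (x0, y0) \<rho>} = ball x0 0" by simp
  then show ?thesis by (rule that)
qed

lemma submean_on_slice_integral:
  fixes g :: "'a::euclidean_space \<Rightarrow> ennreal"
  assumes "submean_on D g" "cball x t \<subseteq> D \<or> t \<le> 0"
  shows "(\<integral>\<^sup>+z. g x * indicator (ball x t) z \<partial>lborel) \<le> (\<integral>\<^sup>+z. g z * indicator (ball x t) z \<partial>lborel)"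
proof (cases "0 < t")
  case True
  have "(\<integral>\<^sup>+z. g x * indicator (ball x t) z \<partial>lborel) = g x * emeasure lborel (ball x t)"
    by (rule nn_integral_cmult_indicator) simp
  also have "\<dots> \<le> (\<integral>\<^sup>+z. g z * indicator (ball x t) z \<partial>lborel)"
    using assms True unfolding submean_on_def nn_integral_completion by auto
  finally show ?thesis .
qed (simp add: not_less ball_empty)

text \<open>
  Writing \<open>B\<close> for the ball around \<open>(x0, y0)\<close>, integration over its slices in \<open>x\<close> gives
  \<open>\<integral>\<^sub>B f (x0, y) \<le> \<integral>\<^sub>B f (x, y)\<close>, and integrating the left-hand side over the slices in \<open>y\<close> gives
  \<open>\<integral>\<^sub>B f (x0, y0) \<le> \<integral>\<^sub>B f (x0, y)\<close>.
\<close>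
lemma submean_on_prod:
  fixes \<Omega> :: "('a::euclidean_space \<times> 'b::euclidean_space) set" and f :: "'a \<times> 'b \<Rightarrow> ennreal"
  assumes usc: "\<And>a. open {z. z \<in> \<Omega> \<and> f z < a}"
    and sx: "\<And>y. submean_on {x. (x, y) \<in> \<Omega>} (\<lambda>x. f (x, y))"
    and sy: "\<And>x. submean_on {y. (x, y) \<in> \<Omega>} (\<lambda>y. f (x, y))"
  shows "submean_on \<Omega> f"
  unfolding submean_on_def
proof clarify
  fix x0 y0 \<rho> assume \<rho>: "0 < \<rho>" and sub: "cball (x0, y0) \<rho> \<subseteq> \<Omega>"
  let ?B = "ball (x0, y0) \<rho>"
  define F where "F = (\<lambda>z. f z * indicator ?B z)"
  have F_m: "F \<in> borel_measurable borel"
  proof (rule borel_measurableI_less)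
    fix a
    have "{z. F z < a} = (if a = 0 then {} else - ?B \<union> (?B \<inter> {z. z \<in> \<Omega> \<and> f z < a}))"
      using sub ball_subset_cball[of "(x0, y0)" \<rho>]
      by (auto simp: F_def zero_less_iff_neq_zero split: split_indicator)
    moreover have "\<dots> \<in> sets borel" using usc[of a] by auto
    ultimately show "{z \<in> space borel. F z < a} \<in> sets borel" by simp
  qed
  define G where "G = (\<lambda>x y. f (x0, y) * indicator ?B (x, y))"
  have center: "(x0, y) \<in> ?B" "(x, y0) \<in> ?B" if "(x, y) \<in> ?B" for x y
  proof -
    have "dist x0 x < \<rho>" "dist y0 y < \<rho>"
      using that dist_fst_le[of "(x0, y0)" "(x, y)"] dist_snd_le[of "(x0, y0)" "(x, y)"] by auto
    then show "(x0, y) \<in> ?B" "(x, y0) \<in> ?B" by (simp_all add: dist_Pair_Pair)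
  qed
  have G_m: "(\<lambda>(x, y). G x y) \<in> borel_measurable (lborel \<Otimes>\<^sub>M lborel)"
  proof -
    have "(\<lambda>(x, y). G x y) = (\<lambda>z. F (x0, snd z) * indicator ?B z)"
      using center by (auto simp: G_def F_def fun_eq_iff split: split_indicator)
    moreover have "(\<lambda>z. F (x0, snd z)) \<in> borel_measurable borel"
      by (rule measurable_compose[OF _ F_m]) (intro borel_measurable_continuous_onI continuous_intros)
    ultimately show ?thesis
      by (auto simp: lborel_prod intro!: borel_measurable_times_ennreal borel_measurable_indicator)
  qed
  have x_step: "(\<integral>\<^sup>+x. G x y \<partial>lborel) \<le> (\<integral>\<^sup>+x. F (x, y) \<partial>lborel)" for y
  proof -
    obtain t where t: "{x. (x, y) \<in> ?B} = ball x0 t" using ball_slice[OF \<rho>] by metis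
    have ind: "indicator ?B (x, y) = (indicator (ball x0 t) x :: ennreal)" for x
      using t by (auto split: split_indicator)
    have "cball x0 t \<subseteq> {x. (x, y) \<in> \<Omega>} \<or> t \<le> 0"
    proof (cases "0 < t")
      case True
      have "cball x0 t = closure {x. (x, y) \<in> ?B}" using True by (simp only: t closure_ball)
      also have "\<dots> \<subseteq> {x. (x, y) \<in> cball (x0, y0) \<rho>}"
      proof (rule closure_minimal)
        show "{x. (x, y) \<in> ?B} \<subseteq> {x. (x, y) \<in> cball (x0, y0) \<rho>}" by auto
        have "closed ((\<lambda>x. (x, y)) -` cball (x0, y0) \<rho>)"
          by (intro closed_vimage continuous_intros) simp
        then show "closed {x. (x, y) \<in> cball (x0, y0) \<rho>}" by (simp add: vimage_def)
      qed
      finally show ?thesis using sub by blast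
    qed simp
    from submean_on_slice_integral[OF sx this] show ?thesis by (simp add: G_def F_def ind)
  qed
  have y_step: "(\<integral>\<^sup>+y. f (x0, y0) * indicator ?B (x, y) \<partial>lborel) \<le> (\<integral>\<^sup>+y. G x y \<partial>lborel)" for x
  proof -
    have swap: "(x, y) \<in> ?B \<longleftrightarrow> (y, x) \<in> ball (y0, x0) \<rho>" for y
      by (simp add: dist_Pair_Pair add.commute)
    obtain t where t: "{y. (y, x) \<in> ball (y0, x0) \<rho>} = ball y0 t" using ball_slice[OF \<rho>] by metis
    have ind: "indicator ?B (x, y) = (indicator (ball y0 t) y :: ennreal)" for y
      using t swap by (auto split: split_indicator)
    have "cball y0 t \<subseteq> {y. (x0, y) \<in> \<Omega>} \<or> t \<le> 0"
    proof (cases "0 < t")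
      case True
      have "cball y0 t = closure {y. (x, y) \<in> ?B}" using True swap by (simp only: t closure_ball)
      also have "\<dots> \<subseteq> {y. (x0, y) \<in> cball (x0, y0) \<rho>}"
      proof (rule closure_minimal)
        show "{y. (x, y) \<in> ?B} \<subseteq> {y. (x0, y) \<in> cball (x0, y0) \<rho>}"
          using center(1) ball_subset_cball by blast
        have "closed ((\<lambda>y. (x0, y)) -` cball (x0, y0) \<rho>)"
          by (intro closed_vimage continuous_intros) simp
        then show "closed {y. (x0, y) \<in> cball (x0, y0) \<rho>}" by (simp add: vimage_def)
      qed
      finally show ?thesis using sub by blast
    qed simp
    from submean_on_slice_integral[OF sy this] show ?thesis by (simp add: G_def ind)
  qed
  have ind_m: "(\<lambda>z. f (x0, y0) * indicator ?B z) \<in> borel_measurable (lborel \<Otimes>\<^sub>M lborel)"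
    by (auto simp: lborel_prod intro!: borel_measurable_times_ennreal borel_measurable_indicator)
  have "f (x0, y0) * emeasure lborel ?B = (\<integral>\<^sup>+z. f (x0, y0) * indicator ?B z \<partial>lborel)"
    by (rule nn_integral_cmult_indicator[symmetric]) simp
  also have "\<dots> = (\<integral>\<^sup>+x. \<integral>\<^sup>+y. f (x0, y0) * indicator ?B (x, y) \<partial>lborel \<partial>lborel)"
    using lborel.nn_integral_fst[OF ind_m] by (simp add: lborel_prod)
  also have "\<dots> \<le> (\<integral>\<^sup>+x. \<integral>\<^sup>+y. G x y \<partial>lborel \<partial>lborel)"
    by (intro nn_integral_mono y_step)
  also have "\<dots> = (\<integral>\<^sup>+y. \<integral>\<^sup>+x. G x y \<partial>lborel \<partial>lborel)"
    using lborel_pair.Fubini'[OF G_m] by simp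
  also have "\<dots> \<le> (\<integral>\<^sup>+y. \<integral>\<^sup>+x. F (x, y) \<partial>lborel \<partial>lborel)"
    by (intro nn_integral_mono x_step)
  also have "\<dots> = (\<integral>\<^sup>+z. F z \<partial>lborel)"
    using lborel_pair.nn_integral_snd[of F] F_m by (simp add: lborel_prod)
  finally show "f (x0, y0) * emeasure lborel ?B \<le> (\<integral>\<^sup>+z\<in>?B. f z \<partial>lebesgue)"
    by (simp add: F_def nn_integral_completion)
qed

lemma usc_on_shift_posI:
  assumes op: "\<And>M. open {z. z \<in> D \<and> shift_pos M u z < 1}" and fin: "\<And>z. z \<in> D \<Longrightarrow> u z < \<infinity>"
  shows "usc_on D u"
  unfolding usc_on_def
proof (intro ballI allI impI)
  fix x a assume x: "x \<in> D" "u x < a"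
  obtain b :: real where b: "u x < ereal b" "ereal b < a"
    using ereal_dense2[OF x(2)] by auto
  have iff: "shift_pos (1 - b) u z < 1 \<longleftrightarrow> u z < ereal b" for z
    unfolding shift_pos_less_iff by (cases "u z") (auto simp: one_ennreal.rep_eq one_ereal_def)
  have "\<forall>\<^sub>F z in at x. z \<in> {z. z \<in> D \<and> shift_pos (1 - b) u z < 1}"
    using op[of "1 - b"] x(1) b(1) unfolding eventually_at_topological
    by (intro exI[of _ "{z. z \<in> D \<and> shift_pos (1 - b) u z < 1}"]) (auto simp: iff)
  then have "\<forall>\<^sub>F z in at x within D. z \<in> {z. z \<in> D \<and> shift_pos (1 - b) u z < 1}"
    by (rule filter_leD[OF at_le, rotated]) simp
  then show "\<forall>\<^sub>F z in at x within D. u z < a"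
    by eventually_elim (use b(2) iff in \<open>auto intro: less_trans\<close>)
qed

lemma open_shift_pos_less:
  assumes "open D" "usc_on D u"
  shows "open {z. z \<in> D \<and> shift_pos M u z < a}"
proof (cases "a = 0")
  case False
  then have "{z. z \<in> D \<and> shift_pos M u z < a} = {z\<in>D. u z < enn2ereal a - ereal M}"
    by (auto simp: shift_pos_less_iff zero_less_iff_neq_zero)
  then show ?thesis using usc_on_less_open[OF assms] by simp
qed simp


section \<open>Separately subharmonic functions\<close>

theorem corollary3:
  fixes \<Omega> :: "((real ^ 'm) \<times> (real ^ 'n)) set"
    and u :: "(real ^ 'm) \<times> (real ^ 'n) \<Rightarrow> ereal"
  assumes "CARD('m) \<ge> 2" and "CARD('n) \<ge> 2"
    and "open \<Omega>" and "connected \<Omega>"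
    and "\<And>z. z \<in> \<Omega> \<Longrightarrow> u z < \<infinity>"
    and "\<And>y. nearly_subharmonic_on {x. (x, y) \<in> \<Omega>} (\<lambda>x. u (x, y))"
    and "AE y in lebesgue. subharmonic_on {x. (x, y) \<in> \<Omega>} (\<lambda>x. u (x, y))"
    and "\<And>x. usc_on {y. (x, y) \<in> \<Omega>} (\<lambda>y. u (x, y))"
    and "AE x in lebesgue. subharmonic_on {y. (x, y) \<in> \<Omega>} (\<lambda>y. u (x, y))"
    and "\<exists>\<psi>. permissible \<psi> \<and> \<not> \<psi> constant_on {0..} \<and>
           locally_integrable_on \<Omega> (\<lambda>z. \<psi> (pos_part u z))"
  shows "subharmonic_on \<Omega> u"
proof -
  note \<Omega> = assms(3) and fin = assms(5) and near = assms(6) and sub_x = assms(7)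
    and usc_y = assms(8) and sub_y = assms(9)
  obtain \<psi> where \<psi>: "permissible \<psi>" "\<not> \<psi> constant_on {0..}"
    "locally_integrable_on \<Omega> (\<lambda>z. \<psi> (pos_part u z))" using assms(10) by blast
  have sep: "separately_submean \<Omega> (shift_pos M u)" for M
  proof
    show "open \<Omega>" by (rule \<Omega>)
    show "(\<lambda>x. shift_pos M u (x, y)) \<in> borel_measurable (lebesgue_on {x. (x, y) \<in> \<Omega>})" for y
      using borel_measurable_shift_pos[of "\<lambda>x. u (x, y)" _ M] near[of y]
      unfolding nearly_subharmonic_on_def shift_pos_def[abs_def] by blast
    show "submean_on {x. (x, y) \<in> \<Omega>} (\<lambda>x. shift_pos M u (x, y))" for y
      using submean_on_shift_pos[of _ "\<lambda>x. u (x, y)" M] near[of y]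
      unfolding nearly_subharmonic_on_def shift_pos_def[abs_def] by blast
    show "AE y in lborel. \<forall>a. open {x. (x, y) \<in> \<Omega> \<and> shift_pos M u (x, y) < a}"
      using sub_x[unfolded AE_completion_iff]
    proof eventually_elim
      case (elim y)
      then show ?case
        using open_shift_pos_less[OF slice_open(1)[OF \<Omega>], of y "\<lambda>x. u (x, y)" M]
        by (simp add: subharmonic_on_def shift_pos_def)
    qed
    show "open {y. (x, y) \<in> \<Omega> \<and> shift_pos M u (x, y) < a}" for x a
      using open_shift_pos_less[OF slice_open(2)[OF \<Omega>] usc_y, of x M a]
      by (simp add: shift_pos_def)
    show "AE x in lborel. submean_on {y. (x, y) \<in> \<Omega>} (\<lambda>y. shift_pos M u (x, y))"
      using sub_y[unfolded AE_completion_iff]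
    proof eventually_elim
      case (elim x)
      then show ?case
        using submean_on_shift_pos[of _ "\<lambda>y. u (x, y)" M]
          usc_on_measurable[OF slice_open(2)[OF \<Omega>], of x "\<lambda>y. u (x, y)"]
        unfolding subharmonic_on_def shift_pos_def[abs_def] by blast
    qed
    fix K assume K: "compact K" "K \<subseteq> \<Omega>"
    obtain L where L: "\<And>z. z \<in> K \<Longrightarrow> u z \<le> ereal L"
      using locally_bounded_above[OF \<Omega> fin near sub_y \<psi> K] by metis
    have "shift_pos M u z \<le> ennreal (max 0 (L + M))" if "z \<in> K" for z
      using L[OF that] by (subst shift_pos_le_iff) (auto intro: order_trans)
    then show "\<exists>L::real. \<forall>z\<in>K. shift_pos M u z \<le> ennreal L" by blast
  qed
  have usc: "usc_on \<Omega> u"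
    using separately_submean.joint_usc[OF sep] fin by (rule usc_on_shift_posI)
  have "submean_on \<Omega> (shift_pos M u)" for M
    using separately_submean.joint_usc[OF sep] separately_submean.submean_x[OF sep]
      separately_submean.submean_y_all[OF sep]
    by (rule submean_on_prod)
  then have "sub_mean_value_on \<Omega> u"
    using \<Omega> usc fin by (intro sub_mean_value_on_shift_posI)
  then show ?thesis using usc fin by (simp add: subharmonic_on_def)
qed

end
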